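(* Let $G$ be a finite abelian group of order $n\ge 2$. (1) If $n$ is odd, then $\mathcal I_{(n-1,1)}(G)=\mathcal I_{(2,1^{n-2})}(G)=0$. (2) If $n\equiv 2\pmod 4$, then $\mathcal I_{(n-1,1)}(G)=\mathcal P(G)$ and $\mathcal I_{(2,1^{n-2})}(G)=\mathcal D(G)$.
   Context: Let $G$ be a finite abelian group of order $n$, written additively, and let $x_g$ ($g\in G$) be commuting indeterminates. The Cayley table of $G$ is the matrix $\mathcal M_G=(x_{a+b})_{a,b\in G}$ (rows and columns are identified with $G$). For a partition $\lambda\vdash n$, let $\chi^\lambda$ be the irreducible complex character of the symmetric group $\mathfrak S_n$ indexed by $\lambda$ (with $\chi^{(n)}$ trivial and $\chi^{(1^n)}=\operatorname{sgn}$), regarded as a character of the group $\mathfrak S(G)$ of permutations of the set $G$ via an identification $\mathfrak S(G)\cong\mathfrak S_n$ (its values depend only on cycle type). The immanant is $\operatorname{imm}_\lambda(\mathcal M_G)=\sum_{\sigma\in\mathfrak S(G)}\chi^\lambda(\sigma)\prod_{a\in G}x_{a+\sigma(a)}$. $\mathcal I_\lambda(G)$ denotes the number of formally different monomials in the $x_g$ occurring (i.e. having nonzero coefficient after collecting terms) in $\operatorname{imm}_\lambda(\mathcal M_G)$. $\mathcal P(G)=\mathcal I_{(n)}(G)$ is this number for the permanent $\operatorname{per}(\mathcal M_G)$, and $\mathcal D(G)=\mathcal I_{(1^n)}(G)$ is this number for the determinant $\det(\mathcal M_G)$. The notation $(2,1^{n-2})$ means the partition with one part $2$ and $n-2$ parts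 $1$. *)

theory Defs
  imports
    Complex_Main
    "HOL-Library.Cardinality"
    "HOL-Library.Poly_Mapping"
    "HOL-Combinatorics.Permutations"
begin

section \<open>Formal linear combinations and the trace on a subspace\<close>

text \<open>
  \<^typ>\<open>'b \<Rightarrow>\<^sub>0 complex\<close> is the complex vector space with basis \<^typ>\<open>'b\<close>.
\<close>

definition scaleF :: "complex \<Rightarrow> ('b \<Rightarrow>\<^sub>0 complex) \<Rightarrow> ('b \<Rightarrow>\<^sub>0 complex)"
  where "scaleF c = Poly_Mapping.map ((*) c)"

lemma lookup_scaleF [simp]: "Poly_Mapping.lookup (scaleF c v) x = c * Poly_Mapping.lookup v x"
  unfolding scaleF_def by (simp add: Poly_Mapping.map.rep_eq when_def)

global_interpretation formal: vector_space scaleF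
  by unfold_locales
    (auto intro!: poly_mapping_eqI simp: lookup_add algebra_simps)

text \<open>The trace of an endomorphism \<open>T\<close> of a finite-dimensional subspace \<open>V\<close>.\<close>

definition trace_on ::
  "('b \<Rightarrow>\<^sub>0 complex) set \<Rightarrow> (('b \<Rightarrow>\<^sub>0 complex) \<Rightarrow> ('b \<Rightarrow>\<^sub>0 complex)) \<Rightarrow> complex"
  where "trace_on V T =
    (let B = (SOME B. formal.independent B \<and> formal.span B = V)
     in \<Sum>b\<in>B. formal.representation B (T b) b)"


section \<open>Specht modules and the irreducible characters of the symmetric group\<close>

text \<open>
  A partition is a weakly decreasing list of positive parts.  The symmetric group acting on the
  finite type \<^typ>\<open>'a\<close> consists of the \<open>\<sigma>\<close> with \<open>\<sigma> permutes UNIV\<close>.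
  A tableau of shape \<open>\<mu>\<close> is stored as the map sending each entry to the (row, column) of its
  cell.  A tabloid, i.e. a row-equivalence class of tableaux, is stored as the map sending each
  entry to its row, so that the tabloid of \<open>T\<close> is \<open>fst \<circ> T\<close>.  A permutation \<open>\<sigma>\<close> acts on
  entries: it takes a tableau or tabloid \<open>t\<close> to \<open>t \<circ> inv \<sigma>\<close>.
\<close>

definition cells :: "nat list \<Rightarrow> (nat \<times> nat) set"
  where "cells \<mu> = {(i, j). i < length \<mu> \<and> j < \<mu> ! i}"

definition tableaux :: "nat list \<Rightarrow> ('a::finite \<Rightarrow> nat \<times> nat) set"
  where "tableaux \<mu> = {T. bij_betw T UNIV (cells \<mu>)}"

definition column_stabilizer :: "('a::finite \<Rightarrow> nat \<times> nat) \<Rightarrow> ('a \<Rightarrow> 'a) set"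
  where "column_stabilizer T = {q. q permutes UNIV \<and> snd \<circ> T \<circ> q = snd \<circ> T}"

definition polytabloid :: "('a::finite \<Rightarrow> nat \<times> nat) \<Rightarrow> ('a \<Rightarrow> nat) \<Rightarrow>\<^sub>0 complex"
  where "polytabloid T =
    (\<Sum>q\<in>column_stabilizer T. Poly_Mapping.single (fst \<circ> T \<circ> inv q) (of_int (sign q)))"

definition specht :: "nat list \<Rightarrow> (('a::finite \<Rightarrow> nat) \<Rightarrow>\<^sub>0 complex) set"
  where "specht \<mu> = formal.span (polytabloid ` tableaux \<mu>)"

text \<open>
  The linear extension of \<open>t \<mapsto> t \<circ> inv \<sigma>\<close>: the coefficient of \<open>\<sigma> v\<close> at a tabloid \<open>r\<close> is the
  coefficient of \<open>v\<close> at \<open>r \<circ> \<sigma>\<close>.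
\<close>

definition perm_action ::
  "('a::finite \<Rightarrow> 'a) \<Rightarrow> (('a \<Rightarrow> nat) \<Rightarrow>\<^sub>0 complex) \<Rightarrow> (('a \<Rightarrow> nat) \<Rightarrow>\<^sub>0 complex)"
  where "perm_action \<sigma> = Poly_Mapping.map_key (\<lambda>r. r \<circ> \<sigma>)"

text \<open>
  The character of the Specht module \<open>specht \<mu>\<close>.  With this convention one row gives the trivial character and one column the sign character;
  see \<open>irr_char_one_row\<close> and \<open>irr_char_one_column\<close> below.
\<close>

definition irr_char :: "nat list \<Rightarrow> ('a::finite \<Rightarrow> 'a) \<Rightarrow> complex"
  where "irr_char \<mu> \<sigma> = trace_on (specht \<mu>) (perm_action \<sigma>)"


section \<open>Immanants of Cayley tables\<close>

text \<open>
  Polynomials over the complex numbers in the indeterminates \<open>x\<^sub>g\<close>: monomials are exponent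
  vectors \<^typ>\<open>'g \<Rightarrow>\<^sub>0 nat\<close>, and multiplication in \<^typ>\<open>('g \<Rightarrow>\<^sub>0 nat) \<Rightarrow>\<^sub>0 complex\<close> is convolution.
\<close>

type_synonym 'g mpoly = "('g \<Rightarrow>\<^sub>0 nat) \<Rightarrow>\<^sub>0 complex"

definition const_poly :: "complex \<Rightarrow> 'g mpoly"
  where "const_poly c = Poly_Mapping.single 0 c"

definition indet :: "'g \<Rightarrow> 'g mpoly"
  where "indet g = Poly_Mapping.single (Poly_Mapping.single g 1) 1"

definition immanant :: "nat list \<Rightarrow> ('a::finite \<Rightarrow> 'a \<Rightarrow> 'g mpoly) \<Rightarrow> 'g mpoly"
  where "immanant \<mu> M =
    (\<Sum>\<sigma> | \<sigma> permutes UNIV. const_poly (irr_char \<mu> \<sigma>) * (\<Prod>a\<in>UNIV. M a (\<sigma> a)))"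

definition cayley_table :: "'g::{finite, ab_group_add} \<Rightarrow> 'g \<Rightarrow> 'g mpoly"
  where "cayley_table a b = indet (a + b)"

definition imm_monomials :: "'g::{finite, ab_group_add} itself \<Rightarrow> nat list \<Rightarrow> nat"
  where "imm_monomials _ \<mu> =
    card (Poly_Mapping.keys (immanant \<mu> (cayley_table :: 'g \<Rightarrow> 'g \<Rightarrow> 'g mpoly)))"

definition per_monomials :: "'g::{finite, ab_group_add} itself \<Rightarrow> nat"
  where "per_monomials G = imm_monomials G [CARD('g)]"

definition det_monomials :: "'g::{finite, ab_group_add} itself \<Rightarrow> nat"
  where "det_monomials G = imm_monomials G (replicate CARD('g) 1)"


section \<open>One-row and one-column shapes\<close>

lemma lookup_perm_action:
  assumes "\<sigma> permutes UNIV"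
  shows "Poly_Mapping.lookup (perm_action \<sigma> v) r = Poly_Mapping.lookup v (r \<circ> \<sigma>)"
proof -
  have "inj (\<lambda>r :: 'a \<Rightarrow> nat. r \<circ> \<sigma>)"
    using permutes_surj[OF assms] by (auto simp: inj_def fun_eq_iff) (metis surjD)
  then show ?thesis
    unfolding perm_action_def by (simp add: Poly_Mapping.map_key.rep_eq)
qed

lemma trace_on_line:
  assumes v: "v \<noteq> 0" and T: "\<And>k. T (scaleF k v) = scaleF c (scaleF k v)"
  shows "trace_on (formal.span {v}) T = c"
proof -
  define B where "B = (SOME B. formal.independent B \<and> formal.span B = formal.span {v})"
  have "\<exists>B. formal.independent B \<and> formal.span B = formal.span {v}"
    using v by (intro exI[of _ "{v}"]) (simp add: formal.dependent_single)
  then have ind: "formal.independent B" and sp: "formal.span B = formal.span {v}"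
    unfolding B_def by (metis (mono_tags, lifting) someI_ex)+
  have "card B = formal.dim (formal.span B)"
    using ind formal.dim_span_eq_card_independent by metis
  also have "\<dots> = formal.dim (formal.span {v})" by (simp only: sp)
  also have "\<dots> = card {v}"
    using v by (intro formal.dim_span_eq_card_independent) (simp add: formal.dependent_single)
  finally have "card B = 1" by simp
  then obtain w where w: "B = {w}" by (auto simp: card_1_singleton_iff)
  have "w \<in> formal.span {v}" using sp w formal.span_base[of w B] by auto
  then obtain k where k: "w = scaleF k v" by (auto simp: formal.span_singleton)
  have "T w = scaleF c w" unfolding k by (rule T)
  then have "formal.representation B (T w) w = c * formal.representation B w w"
    using formal.representation_scale[OF ind formal.span_base, of w c] w by simp
  also have "\<dots> = c" using ind w by (simp add: formal.representation_basis)
  finally show ?thesis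
    unfolding trace_on_def B_def[symmetric] by (simp add: w Let_def)
qed

lemma column_stabilizer_one_row:
  assumes T: "(T :: 'a::finite \<Rightarrow> _) \<in> tableaux [CARD('a)]"
  shows "column_stabilizer T = {id}" "fst \<circ> T = (\<lambda>_. 0)"
proof -
  have bij: "bij_betw T UNIV (cells [CARD('a)])" using T by (simp add: tableaux_def)
  then have cell: "T a \<in> cells [CARD('a)]" for a by (auto simp: bij_betw_def)
  show f: "fst \<circ> T = (\<lambda>_. 0)"
  proof
    show "(fst \<circ> T) a = 0" for a
      using cell[of a] by (auto simp: cells_def)
  qed
  have "inj (snd \<circ> T)"
    using bij f by (auto simp: inj_def bij_betw_def inj_on_def fun_eq_iff prod_eq_iff)
  then show "column_stabilizer T = {id}"
    by (auto simp: column_stabilizer_def fun_eq_iff inj_def permutes_id)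
qed

lemma tableaux_nonempty:
  assumes "card (cells \<mu>) = CARD('a::finite)" "finite (cells \<mu>)"
  shows "\<exists>T :: 'a \<Rightarrow> _. T \<in> tableaux \<mu>"
  using assms finite_same_card_bij[of "UNIV :: 'a set" "cells \<mu>"] by (auto simp: tableaux_def)

theorem irr_char_one_row:
  assumes s: "(\<sigma> :: 'a::finite \<Rightarrow> 'a) permutes UNIV"
  shows "irr_char [CARD('a)] \<sigma> = 1"
proof -
  let ?v = "Poly_Mapping.single (\<lambda>_. 0) 1 :: ('a \<Rightarrow> nat) \<Rightarrow>\<^sub>0 complex"
  have cl: "cells [CARD('a)] = {0} \<times> {..<CARD('a)}" by (auto simp: cells_def)
  have pt: "polytabloid T = ?v" if "T \<in> tableaux [CARD('a)]" for T :: "'a \<Rightarrow> _"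
    using column_stabilizer_one_row[OF that] by (simp add: polytabloid_def sign_id)
  have "\<exists>T :: 'a \<Rightarrow> _. T \<in> tableaux [CARD('a)]"
    by (rule tableaux_nonempty) (simp_all add: cl card_cartesian_product)
  then have "polytabloid ` (tableaux [CARD('a)] :: ('a \<Rightarrow> _) set) = {?v}"
    using pt by (auto simp: image_iff)
  then have sp: "specht [CARD('a)] = formal.span {?v}" by (simp add: specht_def)
  have eq: "(r \<circ> \<sigma> = (\<lambda>_. 0)) = (r = (\<lambda>_. 0))" for r :: "'a \<Rightarrow> nat"
    using permutes_surj[OF s] by (auto simp: fun_eq_iff) (metis surjD)
  have "trace_on (formal.span {?v}) (perm_action \<sigma>) = 1"
  proof (rule trace_on_line)
    show "?v \<noteq> 0" by (metis lookup_single_eq lookup_zero one_neq_zero)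
    show "perm_action \<sigma> (scaleF k ?v) = scaleF 1 (scaleF k ?v)" for k
      by (rule poly_mapping_eqI)
        (auto simp: lookup_perm_action[OF s] lookup_single when_def eq eq_commute[of "\<lambda>_. 0"])
  qed
  then show ?thesis by (simp add: irr_char_def sp)
qed

definition alternating :: "('a::finite \<Rightarrow> nat) \<Rightarrow> ('a \<Rightarrow> nat) \<Rightarrow>\<^sub>0 complex"
  where "alternating f =
    (\<Sum>q | q permutes UNIV. Poly_Mapping.single (f \<circ> inv q) (of_int (sign q)))"

lemma lookup_alternating:
  "Poly_Mapping.lookup (alternating f) r =
    (\<Sum>q | q permutes UNIV. if f \<circ> inv q = r then of_int (sign q) else 0)"
  by (simp add: alternating_def lookup_sum lookup_single when_def)

lemma sign_compose_UNIV:
  assumes "(p :: 'a::finite \<Rightarrow> 'a) permutes UNIV" "q permutes UNIV"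
  shows "sign (p \<circ> q) = sign p * sign q"
  using assms by (intro sign_compose permutes_imp_permutation[of UNIV]) auto

lemma alternating_compose:
  assumes p: "(p :: 'a::finite \<Rightarrow> 'a) permutes UNIV"
  shows "alternating (f \<circ> p) = scaleF (of_int (sign p)) (alternating f)"
proof (rule poly_mapping_eqI)
  fix r
  have inv: "f \<circ> p \<circ> inv (q \<circ> p) = f \<circ> inv q" if "q permutes UNIV" for q
    using permutes_inv_o(1)[OF p] permutes_bij[OF p] permutes_bij[OF that]
    by (simp add: o_inv_distrib comp_assoc fun_eq_iff)
  have "Poly_Mapping.lookup (alternating (f \<circ> p)) r =
      (\<Sum>q | q permutes UNIV. if f \<circ> p \<circ> inv (q \<circ> p) = r then of_int (sign (q \<circ> p)) else 0)"
    unfolding lookup_alternating by (rule sum_permutations_compose_right[OF p])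
  also have "\<dots> = (\<Sum>q | q permutes UNIV.
      of_int (sign p) * (if f \<circ> inv q = r then of_int (sign q) else 0))"
    by (intro sum.cong refl) (auto simp: inv sign_compose_UNIV p)
  finally show "Poly_Mapping.lookup (alternating (f \<circ> p)) r =
      Poly_Mapping.lookup (scaleF (of_int (sign p)) (alternating f)) r"
    by (simp add: lookup_alternating sum_distrib_left)
qed

lemma perm_action_alternating:
  assumes p: "(p :: 'a::finite \<Rightarrow> 'a) permutes UNIV"
  shows "perm_action p (alternating f) = scaleF (of_int (sign p)) (alternating f)"
proof (rule poly_mapping_eqI)
  fix r
  have inv: "f \<circ> inv (p \<circ> q) = r \<longleftrightarrow> f \<circ> inv q = r \<circ> p" if "q permutes UNIV" for q
  proof -
    have "inv (p \<circ> q) = inv q \<circ> inv p"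
      using permutes_bij[OF p] permutes_bij[OF that] by (simp add: o_inv_distrib)
    then show ?thesis
      using permutes_inv_o[OF p] by (metis comp_assoc comp_id)
  qed
  have sq: "of_int (sign p) * (of_int (sign p) * c) = (c :: complex)" for c
    by (simp add: sign_def)
  have "Poly_Mapping.lookup (scaleF (of_int (sign p)) (alternating f)) r =
      of_int (sign p) *
      (\<Sum>q | q permutes UNIV. if f \<circ> inv (p \<circ> q) = r then of_int (sign (p \<circ> q)) else 0)"
    unfolding lookup_scaleF lookup_alternating
    by (subst setum_permutations_compose_left[OF p]) simp
  also have "\<dots> = (\<Sum>q | q permutes UNIV. if f \<circ> inv q = r \<circ> p then of_int (sign q) else 0)"
    unfolding sum_distrib_left
    by (intro sum.cong refl) (auto simp: inv sign_compose_UNIV p sq)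
  finally show "Poly_Mapping.lookup (perm_action p (alternating f)) r =
      Poly_Mapping.lookup (scaleF (of_int (sign p)) (alternating f)) r"
    by (simp add: lookup_perm_action[OF p] lookup_alternating)
qed

lemma alternating_nonzero:
  assumes "inj (f :: 'a::finite \<Rightarrow> nat)"
  shows "alternating f \<noteq> 0"
proof -
  have iff: "(f \<circ> inv q = f) = (q = id)" if "q permutes UNIV" for q
  proof -
    have "f \<circ> inv q = f \<longleftrightarrow> inv q = id"
      using assms by (auto simp: fun_eq_iff inj_def)
    also have "\<dots> \<longleftrightarrow> q = id"
      using that by (metis inv_id permutes_inv_inv)
    finally show ?thesis .
  qed
  have "Poly_Mapping.lookup (alternating f) f =
      (\<Sum>q :: 'a \<Rightarrow> 'a | q permutes UNIV. if q = id then of_int (sign q) else 0)"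
    unfolding lookup_alternating by (intro sum.cong refl) (simp only: iff mem_Collect_eq)
  also have "\<dots> = 1" by (simp add: sum.delta permutes_id)
  finally show ?thesis by auto
qed

theorem irr_char_one_column:
  assumes s: "(\<sigma> :: 'a::finite \<Rightarrow> 'a) permutes UNIV"
  shows "irr_char (replicate CARD('a) 1) \<sigma> = of_int (sign \<sigma>)"
proof -
  let ?l = "replicate CARD('a) 1"
  have cl: "cells ?l = {..<CARD('a)} \<times> {0}" by (auto simp: cells_def)
  have "\<exists>T :: 'a \<Rightarrow> _. T \<in> tableaux ?l"
    by (rule tableaux_nonempty) (simp_all add: cl card_cartesian_product del: One_nat_def)
  then obtain T0 :: "'a \<Rightarrow> nat \<times> nat" where T0: "T0 \<in> tableaux ?l" ..
  have col: "snd \<circ> T = (\<lambda>_. 0)" if "T \<in> tableaux ?l" for T :: "'a \<Rightarrow> nat \<times> nat"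
  proof
    have "T a \<in> cells ?l" for a using that by (auto simp: tableaux_def bij_betw_def)
    then show "(snd \<circ> T) a = 0" for a unfolding cl by (simp add: mem_Times_iff)
  qed
  have pt: "polytabloid T = alternating (fst \<circ> T)" if "T \<in> tableaux ?l"
    for T :: "'a \<Rightarrow> nat \<times> nat"
    using col[OF that]
    by (simp add: polytabloid_def alternating_def column_stabilizer_def comp_def)
  define v where "v = polytabloid T0"
  have "inj (fst \<circ> T0)"
    using T0 col[OF T0]
    by (auto simp: tableaux_def inj_def bij_betw_def inj_on_def fun_eq_iff prod_eq_iff)
  then have v0: "v \<noteq> 0" by (simp add: v_def pt[OF T0] alternating_nonzero)
  have "polytabloid T \<in> formal.span {v}" if T: "T \<in> tableaux ?l" for T :: "'a \<Rightarrow> nat \<times> nat"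
  proof -
    have b: "bij_betw T UNIV (cells ?l)" "bij_betw T0 UNIV (cells ?l)"
      using T T0 by (simp_all add: tableaux_def)
    define p where "p = inv_into UNIV T0 \<circ> T"
    have "bij p"
      unfolding p_def using b bij_betw_inv_into bij_betw_trans by blast
    then have p: "p permutes UNIV" by (intro bij_imp_permutes) auto
    have "T0 \<circ> p = T"
      using b by (auto simp: p_def fun_eq_iff bij_betw_def) (metis f_inv_into_f rangeI)
    then have "polytabloid T = scaleF (of_int (sign p)) v"
      using alternating_compose[OF p, of "fst \<circ> T0"]
      by (simp add: pt[OF T] pt[OF T0] v_def comp_assoc)
    then show ?thesis by (auto simp: formal.span_singleton)
  qed
  then have "specht ?l \<subseteq> formal.span {v}"
    unfolding specht_def by (intro formal.span_minimal) auto
  moreover have "formal.span {v} \<subseteq> specht ?l"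
    unfolding specht_def v_def using T0 by (intro formal.span_mono) auto
  ultimately have sp: "specht ?l = formal.span {v}" by simp
  have "trace_on (formal.span {v}) (perm_action \<sigma>) = of_int (sign \<sigma>)"
  proof (rule trace_on_line[OF v0])
    fix k
    have "perm_action \<sigma> (scaleF k v) = scaleF k (perm_action \<sigma> v)"
      by (rule poly_mapping_eqI) (simp add: lookup_perm_action[OF s])
    then show "perm_action \<sigma> (scaleF k v) = scaleF (of_int (sign \<sigma>)) (scaleF k v)"
      by (simp add: v_def pt[OF T0] perm_action_alternating[OF s] mult.commute)
  qed
  then show ?thesis by (simp only: irr_char_def sp)
qed

corollary immanant_one_row:
  "immanant [CARD('a)] (M :: 'a::finite \<Rightarrow> 'a \<Rightarrow> 'g mpoly) =
    (\<Sum>\<sigma> | \<sigma> permutes UNIV. \<Prod>a\<in>UNIV. M a (\<sigma> a))"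
  unfolding immanant_def const_poly_def
  by (intro sum.cong refl) (simp add: irr_char_one_row del: One_nat_def)

corollary immanant_one_column:
  "immanant (replicate CARD('a) 1) (M :: 'a::finite \<Rightarrow> 'a \<Rightarrow> 'g mpoly) =
    (\<Sum>\<sigma> | \<sigma> permutes UNIV. of_int (sign \<sigma>) * (\<Prod>a\<in>UNIV. M a (\<sigma> a)))"
  unfolding immanant_def const_poly_def
  by (intro sum.cong refl)
    (auto simp: irr_char_one_column sign_def single_uminus simp del: One_nat_def)

end

theory Submission
  imports Defs
begin

text \<open>
  The irreducible characters of the shapes \<open>(n-1, 1)\<close> and \<open>(2, 1, \<dots>, 1)\<close> are \<open>fix \<sigma> - 1\<close> and
  \<open>sign \<sigma> * (fix \<sigma> - 1)\<close>, where \<open>fix \<sigma>\<close> is the number of fixed points of \<open>\<sigma>\<close>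
  (\<open>irr_char_standard\<close>, \<open>irr_char_standard_sign\<close>).  Both follow from explicit bases of the Specht
  modules together with dual functionals (\<open>trace_on_dual_family\<close>).

  Let \<open>\<epsilon>\<close> be 1 or the sign.  The coefficient of a monomial \<open>m\<close> in the immanant is the sum of
  \<open>\<epsilon> \<sigma> * (fix \<sigma> - 1)\<close> over the permutations \<open>\<sigma>\<close> for which the product of the
  indeterminates at \<open>a + \<sigma> a\<close> is \<open>m\<close>; without the factor \<open>fix \<sigma> - 1\<close> it is the coefficient in
  the permanent or determinant.  For a group element \<open>c\<close>, the permutation \<open>a \<mapsto> \<sigma> (a + c) + c\<close> has
  the same monomial and the same sign as \<open>\<sigma>\<close>.  So \<open>fix \<sigma>\<close> may be replaced by its average over
  all \<open>c\<close> (\<open>average_over_translates\<close>), and this average is the number of pairs \<open>(b, c)\<close> with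
  \<open>2c = b - \<sigma> b\<close>, divided by \<open>n\<close>.

  If \<open>n\<close> is odd, doubling is bijective, the average is 1, and every coefficient vanishes.

  If \<open>n\<close> is 2 modulo 4, the doubles form a subgroup \<open>H\<close> of index 2 and doubling is two-to-one onto
  \<open>H\<close>.  The average is \<open>2k / n\<close>, where \<open>k\<close> counts the \<open>b\<close> with \<open>b - \<sigma> b \<in> H\<close>, equivalently with
  \<open>b + \<sigma> b \<in> H\<close>; hence \<open>k\<close> is determined by \<open>m\<close>.  So the coefficient in the immanant is
  \<open>(2k - n) / n\<close> times the coefficient in the permanent or determinant.  The number \<open>k\<close> is even
  (\<open>even_card_doubles\<close>) and \<open>n / 2\<close> is odd, so the factor never vanishes, and the same monomials
  occur.
\<close>

section \<open>Traces from dual functionals\<close>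

text \<open>
  The trace on a subspace is defined through an arbitrary basis \<open>B\<close>.  Expanding each
  \<open>b \<in> B\<close> in the family \<open>f\<close> with the dual functionals \<open>\<phi>\<close>, and each \<open>T (f i)\<close> in \<open>B\<close>,
  turns the trace over \<open>B\<close> into the trace over \<open>f\<close> by exchanging two sums.  So a trace can be
  read off a spanning family as soon as dual functionals are known.
\<close>
lemma trace_on_dual_family:
  fixes f :: "'i \<Rightarrow> 'b \<Rightarrow>\<^sub>0 complex"
  assumes fin: "finite I"
    and \<phi>: "\<And>i. i \<in> I \<Longrightarrow> module_hom scaleF (*) (\<phi> i)"
    and dual: "\<And>i j. i \<in> I \<Longrightarrow> j \<in> I \<Longrightarrow> \<phi> i (f j) = of_bool (i = j)"
    and T: "module_hom scaleF scaleF T"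
    and inv: "\<And>i. i \<in> I \<Longrightarrow> T (f i) \<in> formal.span (f ` I)"
  shows "trace_on (formal.span (f ` I)) T = (\<Sum>i\<in>I. \<phi> i (T (f i)))"
proof -
  define V where "V = formal.span (f ` I)"
  have expand: "v = (\<Sum>i\<in>I. scaleF (\<phi> i v) (f i))" if "v \<in> V" for v
    using that unfolding V_def
  proof (induction rule: formal.span_induct_alt)
    case base
    show ?case by (simp add: module_hom.zero[OF \<phi>])
  next
    case (step c x y)
    then obtain j where j: "j \<in> I" "x = f j" by auto
    have "(\<Sum>i\<in>I. scaleF (\<phi> i (scaleF c x + y)) (f i)) =
        (\<Sum>i\<in>I. if i = j then scaleF c (f i) else 0) + (\<Sum>i\<in>I. scaleF (\<phi> i y) (f i))"
      unfolding sum.distrib[symmetric]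
      by (intro sum.cong refl)
        (auto simp: module_hom.add[OF \<phi>] module_hom.scale[OF \<phi>] j dual formal.scale_left_distrib)
    also have "\<dots> = scaleF c x + y"
      using fin j step.IH by simp
    finally show ?case by simp
  qed
  define B where "B = (SOME B. formal.independent B \<and> formal.span B = V)"
  have "\<exists>B. formal.independent B \<and> formal.span B = V"
    by (metis V_def formal.basis_exists formal.span_subspace formal.subspace_span)
  then have ind: "formal.independent B" and sp: "formal.span B = V"
    unfolding B_def by (metis (mono_tags, lifting) someI_ex)+
  have "B \<subseteq> formal.span (f ` I)" using formal.span_superset[of B] sp V_def by simp
  then have finB: "finite B"
    using formal.independent_span_bound[of "f ` I" B] fin ind by auto
  have TfV: "T (f i) \<in> formal.span B" if "i \<in> I" for i
    using inv[OF that] by (simp add: sp V_def)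
  have "(\<Sum>b\<in>B. formal.representation B (T b) b) =
      (\<Sum>b\<in>B. \<Sum>i\<in>I. \<phi> i b * formal.representation B (T (f i)) b)"
  proof (rule sum.cong[OF refl])
    fix b assume "b \<in> B"
    then have "b \<in> V" using formal.span_base sp by blast
    then have "T b = T (\<Sum>i\<in>I. scaleF (\<phi> i b) (f i))" using expand by metis
    also have "\<dots> = (\<Sum>i\<in>I. scaleF (\<phi> i b) (T (f i)))"
      by (simp add: module_hom.sum[OF T] module_hom.scale[OF T])
    finally have "formal.representation B (T b) =
        (\<lambda>v. \<Sum>i\<in>I. formal.representation B (scaleF (\<phi> i b) (T (f i))) v)"
      using formal.representation_sum[OF ind, of I "\<lambda>i. scaleF (\<phi> i b) (T (f i))"]
      by (simp add: TfV formal.span_scale)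
    then show "formal.representation B (T b) b =
        (\<Sum>i\<in>I. \<phi> i b * formal.representation B (T (f i)) b)"
      by (simp add: formal.representation_scale[OF ind TfV])
  qed
  also have "\<dots> = (\<Sum>i\<in>I. \<Sum>b\<in>B. \<phi> i b * formal.representation B (T (f i)) b)"
    by (rule sum.swap)
  also have "\<dots> = (\<Sum>i\<in>I. \<phi> i (T (f i)))"
  proof (rule sum.cong[OF refl])
    fix i assume i: "i \<in> I"
    have "T (f i) = (\<Sum>b\<in>B. scaleF (formal.representation B (T (f i)) b) b)"
      using formal.sum_representation_eq[OF ind TfV[OF i] finB order_refl] by simp
    then have "\<phi> i (T (f i)) = \<phi> i (\<Sum>b\<in>B. scaleF (formal.representation B (T (f i)) b) b)"
      by simp
    also have "\<dots> = (\<Sum>b\<in>B. formal.representation B (T (f i)) b * \<phi> i b)"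
      by (simp add: module_hom.sum[OF \<phi>[OF i]] module_hom.scale[OF \<phi>[OF i]])
    finally show "(\<Sum>b\<in>B. \<phi> i b * formal.representation B (T (f i)) b) = \<phi> i (T (f i))"
      by (simp add: mult.commute)
  qed
  finally show ?thesis
    unfolding trace_on_def V_def[symmetric] B_def[symmetric] by (simp add: Let_def)
qed

lemma module_hom_lookup: "module_hom scaleF (*) (\<lambda>v. c * Poly_Mapping.lookup v r)"
  by (intro module_hom.intro formal.module_axioms module_hom_axioms.intro)
    (auto simp: lookup_add algebra_simps module_def)

lemma module_hom_perm_action:
  "\<sigma> permutes UNIV \<Longrightarrow> module_hom scaleF scaleF (perm_action \<sigma>)"
  by (intro module_hom.intro formal.module_axioms module_hom_axioms.intro poly_mapping_eqI)
    (auto simp: lookup_add lookup_perm_action)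

text \<open>
  Up to a common sign, the summands are the diagonal entries of the matrix of \<open>\<tau>\<close> or \<open>inv \<tau>\<close>
  in the two \<open>(n-1)\<close>-dimensional Specht modules below.  The term \<open>d = z\<close> would contribute
  nothing, so the sum may be taken over all points.
\<close>
lemma sum_fixed_points_minus_one:
  assumes \<tau>: "(\<tau> :: 'a::finite \<Rightarrow> 'a) permutes UNIV"
  shows "(\<Sum>d\<in>-{z}. of_bool (\<tau> d = d) - of_bool (\<tau> d = z)) = (of_nat (card {x. \<tau> x = x}) - 1 :: complex)"
proof -
  have "(\<Sum>d\<in>-{z}. of_bool (\<tau> d = d) - of_bool (\<tau> d = z)) =
      (\<Sum>d\<in>UNIV. of_bool (\<tau> d = d) - of_bool (\<tau> d = z) :: complex)"
    by (rule sum.mono_neutral_left) auto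
  also have "\<dots> = of_nat (card {x. \<tau> x = x}) - of_nat (card {x. \<tau> x = z})"
    by (simp add: sum_subtractf of_bool_def sum.If_cases)
  also have "{x. \<tau> x = z} = {inv \<tau> z}"
    using permutes_inverses[OF \<tau>] by auto
  finally show ?thesis by simp
qed

section \<open>The character of shape \<open>(n-1, 1)\<close>\<close>

lemma exists_permutation_two_points:
  fixes a b c d :: 'a
  assumes "a \<noteq> b" "c \<noteq> d"
  obtains p where "p permutes UNIV" "p a = c" "p b = d"
proof
  let ?t = "transpose a c"
  show "transpose (?t b) d \<circ> ?t permutes UNIV"
    by (intro permutes_compose permutes_swap_id) auto
  have "?t b \<noteq> c" using assms by (auto simp: transpose_def)
  then show "(transpose (?t b) d \<circ> ?t) a = c" "(transpose (?t b) d \<circ> ?t) b = d"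
    using assms by (auto simp: transpose_def)
qed

lemma exists_tableau_two_cells:
  fixes a b :: "'a::finite"
  assumes "finite (cells \<mu>)" "card (cells \<mu>) = CARD('a)"
    and "x \<in> cells \<mu>" "y \<in> cells \<mu>" "a \<noteq> b" "x \<noteq> y"
  obtains T where "T \<in> tableaux \<mu>" "T a = x" "T b = y"
proof -
  obtain T0 :: "'a \<Rightarrow> nat \<times> nat" where T0: "bij_betw T0 UNIV (cells \<mu>)"
    using tableaux_nonempty assms by (auto simp: tableaux_def)
  then obtain c d where "T0 c = x" "T0 d = y"
    using assms unfolding bij_betw_def by (metis imageE)
  moreover from this obtain p where "p permutes UNIV" "p a = c" "p b = d"
    using exists_permutation_two_points[of a b c d] assms by auto
  moreover from this have "bij_betw (T0 \<circ> p) UNIV (cells \<mu>)"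
    using T0 permutes_bij bij_betw_trans by blast
  ultimately show thesis using that[of "T0 \<circ> p"] by (simp add: tableaux_def)
qed

lemma cells_standard: "cells [k, Suc 0] = insert (Suc 0, 0) ({0} \<times> {..<k})"
  by (auto simp: cells_def less_Suc_eq nth_Cons split: nat.splits)

text \<open>
  A tabloid of shape \<open>(n-1, 1)\<close> is the choice of the entry in the second row, so it is the
  indicator function of a point.  Only the first column, with the entries
  \<open>a\<close> and \<open>b\<close>, has two cells, so their transposition generates the column stabilizer.
\<close>
lemma polytabloid_standard:
  assumes T: "(T :: 'a::finite \<Rightarrow> _) \<in> tableaux [k, 1]" and a: "T a = (0, 0)" and b: "T b = (1, 0)"
  shows "polytabloid T = Poly_Mapping.single (\<lambda>x. of_bool (x = b)) 1
                       - Poly_Mapping.single (\<lambda>x. of_bool (x = a)) 1"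
proof -
  have inj: "T x = T y \<longleftrightarrow> x = y" for x y
    using T by (auto simp: tableaux_def bij_betw_def inj_eq)
  have cell: "T x = (1, 0) \<or> fst (T x) = 0" for x
  proof -
    have "T x \<in> cells [k, 1]" using T by (auto simp: tableaux_def bij_betw_def)
    then show ?thesis by (auto simp: cells_standard)
  qed
  have ab: "a \<noteq> b" using a b by auto
  have row: "fst \<circ> T = (\<lambda>x. of_bool (x = b))"
  proof
    fix x show "(fst \<circ> T) x = of_bool (x = b)"
      using cell[of x] inj[of x b] b by auto
  qed
  have "column_stabilizer T = {id, transpose a b}"
  proof (intro equalityI subsetI)
    fix q assume "q \<in> column_stabilizer T"
    then have q: "q permutes UNIV" and col: "snd (T (q x)) = snd (T x)" for x
      by (auto simp: column_stabilizer_def fun_eq_iff)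
    have "q x = x" if "x \<notin> {a, b}" for x
      using that col[of x] cell[of x] cell[of "q x"] inj[of x a] inj[of x b] inj[of "q x" x] a b
      by (auto simp: prod_eq_iff)
    then have "q permutes {a, b}" using q by (auto intro: permutes_superset)
    then show "q \<in> {id, transpose a b}" by (simp add: permutes_doubleton_iff)
  next
    fix q assume "q \<in> {id, transpose a b}"
    moreover from this have "q permutes UNIV" by (auto intro: permutes_id permutes_swap_id)
    ultimately show "q \<in> column_stabilizer T"
      using a b by (auto simp: column_stabilizer_def fun_eq_iff transpose_def)
  qed
  moreover have "fst \<circ> T \<circ> transpose a b = (\<lambda>x. of_bool (x = a))"
    using ab by (auto simp: row fun_eq_iff transpose_def)
  moreover have "id \<noteq> transpose a b" using ab by (metis id_apply transpose_apply_first)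
  ultimately show ?thesis
    using ab by (simp add: polytabloid_def sign_id sign_swap_id row single_uminus)
qed

text \<open>
  With \<open>e d\<close> the tabloid that has \<open>d\<close> in its second row, the Specht module is spanned by the
  differences \<open>e d - e z\<close> with \<open>d \<noteq> z\<close> for some chosen point \<open>z\<close>; the coefficients at the tabloids
  \<open>e d\<close> are dual to them.
\<close>
theorem irr_char_standard:
  assumes s: "(\<sigma> :: 'a::finite \<Rightarrow> 'a) permutes UNIV" and n: "CARD('a) \<ge> 2"
  shows "irr_char [CARD('a) - 1, 1] \<sigma> = of_nat (card {x. \<sigma> x = x}) - 1"
proof -
  let ?\<mu> = "[CARD('a) - 1, 1]"
  let ?\<delta> = "\<lambda>d x :: 'a. of_bool (x = d) :: nat"
  let ?L = "Poly_Mapping.lookup :: (('a \<Rightarrow> nat) \<Rightarrow>\<^sub>0 complex) \<Rightarrow> _"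
  define z :: 'a where "z = undefined"
  define f where "f d = Poly_Mapping.single (?\<delta> d) (1::complex) - Poly_Mapping.single (?\<delta> z) 1" for d
  define V where "V = formal.span (f ` (-{z}))"
  have \<delta>: "?\<delta> c = ?\<delta> d \<longleftrightarrow> c = d" for c d by (auto simp: fun_eq_iff)
  have fV: "f d \<in> V" for d
  proof (cases "d = z")
    case True
    then show ?thesis by (simp add: f_def V_def formal.span_zero)
  qed (auto simp: V_def intro!: formal.span_base)
  have Lf: "?L (f d) (?\<delta> c) = of_bool (c = d) - of_bool (c = z)" for c d
    by (simp add: f_def lookup_minus lookup_single when_def \<delta> eq_commute)
  have card: "card (cells ?\<mu>) = CARD('a)" "finite (cells ?\<mu>)"
    using n by (auto simp: cells_standard card_insert_if card_cartesian_product)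
  have "polytabloid T \<in> V" if T: "T \<in> tableaux ?\<mu>" for T :: "'a \<Rightarrow> _"
  proof -
    have "(0, 0) \<in> range T" "(1, 0) \<in> range T"
      using T n by (auto simp: tableaux_def bij_betw_def cells_standard)
    then obtain a b where ab: "T a = (0, 0)" "T b = (1, 0)" by (metis rangeE)
    have "polytabloid T = f b - f a"
      by (simp add: polytabloid_standard[OF T ab] f_def)
    then show ?thesis using fV V_def by (simp add: formal.span_diff)
  qed
  then have "specht ?\<mu> \<subseteq> V"
    unfolding specht_def V_def by (intro formal.span_minimal) auto
  moreover have "f d \<in> specht ?\<mu>" if dz: "d \<noteq> z" for d
  proof -
    have "(0, 0) \<in> cells ?\<mu>" "(1, 0) \<in> cells ?\<mu>"
      using n by (auto simp: cells_standard)
    then obtain T where T: "T \<in> tableaux ?\<mu>" "T z = (0, 0)" "T d = (1, 0)"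
      by (rule exists_tableau_two_cells[OF card(2,1), of "(0, 0)" "(1, 0)" z d]) (use dz in auto)
    then show ?thesis
      using polytabloid_standard[OF T] unfolding specht_def f_def
      by (metis formal.span_base imageI)
  qed
  then have "V \<subseteq> specht ?\<mu>"
    unfolding specht_def V_def by (intro formal.span_minimal) auto
  ultimately have sp: "specht ?\<mu> = formal.span (f ` (-{z}))" by (simp add: V_def)
  have \<delta>s: "?\<delta> d \<circ> \<sigma> = ?\<delta> (inv \<sigma> d)" for d
    using permutes_inverses[OF s] by (auto simp: fun_eq_iff)
  have act: "perm_action \<sigma> (f d) = f (\<sigma> d) - f (\<sigma> z)" for d
  proof (rule poly_mapping_eqI)
    fix r :: "'a \<Rightarrow> nat"
    have "r \<circ> \<sigma> = ?\<delta> c \<longleftrightarrow> r = ?\<delta> (\<sigma> c)" for c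
    proof -
      have "r \<circ> \<sigma> = ?\<delta> c \<longleftrightarrow> r \<circ> \<sigma> = ?\<delta> (\<sigma> c) \<circ> \<sigma>"
        using \<delta>s permutes_inverses[OF s] by simp
      also have "\<dots> \<longleftrightarrow> r = ?\<delta> (\<sigma> c)"
        using permutes_surj[OF s] by (metis surj_fun_eq  comp_assoc comp_id permutes_inv_o(1) s)
      finally show ?thesis .
    qed
    then show "?L (perm_action \<sigma> (f d)) r = ?L (f (\<sigma> d) - f (\<sigma> z)) r"
      by (simp add: lookup_perm_action[OF s] f_def lookup_minus lookup_single when_def
          eq_commute[of "?\<delta> _"])
  qed
  have hom: "module_hom scaleF (*) (\<lambda>v. ?L v r)" for r
    using module_hom_lookup[of 1 r] by simp
  have "trace_on (formal.span (f ` (-{z}))) (perm_action \<sigma>) =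
      (\<Sum>d\<in>-{z}. ?L (perm_action \<sigma> (f d)) (?\<delta> d))"
  proof (rule trace_on_dual_family)
    show "module_hom scaleF (*) (\<lambda>v. ?L v (?\<delta> d))" for d by (rule hom)
    show "?L (f e) (?\<delta> d) = of_bool (d = e)" if "d \<in> -{z}" "e \<in> -{z}" for d e
      using that by (simp add: Lf)
    show "perm_action \<sigma> (f d) \<in> formal.span (f ` (-{z}))" for d
      using fV V_def by (simp add: act formal.span_diff)
  qed (simp_all add: module_hom_perm_action s)
  also have "\<dots> = (\<Sum>d\<in>-{z}. of_bool (inv \<sigma> d = d) - of_bool (inv \<sigma> d = z))"
    by (simp add: lookup_perm_action[OF s] \<delta>s Lf)
  also have "\<dots> = of_nat (card {x. inv \<sigma> x = x}) - 1"
    by (rule sum_fixed_points_minus_one[OF permutes_inv[OF s]])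
  also have "{x. inv \<sigma> x = x} = {x. \<sigma> x = x}"
    using permutes_inverses[OF s] by (metis (no_types, lifting))
  finally show ?thesis by (simp only: irr_char_def sp)
qed

section \<open>The character of shape \<open>(2, 1, \<dots>, 1)\<close>\<close>

text \<open>
  For the shape \<open>(2, 1, \<dots>, 1)\<close> every column stabilizer is a point stabilizer, and all tableaux are
  \<open>T \<circ> p\<close> for one tableau \<open>T\<close>.  With \<open>\<rho> = fst \<circ> T\<close> and \<open>z\<close> the entry of the second column of
  \<open>T\<close>, the polytabloid of \<open>T \<circ> p\<close> is, up to sign, the signed sum over the coset of all
  permutations that send the entry \<open>d\<close> of the second column of \<open>T \<circ> p\<close> to \<open>z\<close>.  Summing over the
  coset, rather than over the stabilizer of one tableau, fixes the signs uniformly.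
\<close>
definition signed_coset_sum :: "('a::finite \<Rightarrow> nat) \<Rightarrow> 'a \<Rightarrow> 'a \<Rightarrow> ('a \<Rightarrow> nat) \<Rightarrow>\<^sub>0 complex"
  where "signed_coset_sum \<rho> z d =
    (\<Sum>p | p permutes UNIV \<and> p d = z. Poly_Mapping.single (\<rho> \<circ> p) (of_int (sign p)))"

lemma lookup_signed_coset_sum:
  "Poly_Mapping.lookup (signed_coset_sum \<rho> z d) r =
    (\<Sum>p | p permutes UNIV \<and> p d = z. if \<rho> \<circ> p = r then of_int (sign p) else 0)"
  by (simp add: signed_coset_sum_def lookup_sum lookup_single when_def)

lemma sign_inv_UNIV: "(p :: 'a::finite \<Rightarrow> 'a) permutes UNIV \<Longrightarrow> sign (inv p) = sign p"
  by (intro sign_inverse permutes_imp_permutation[of UNIV]) auto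

lemma perm_action_signed_coset_sum:
  assumes s: "(\<sigma> :: 'a::finite \<Rightarrow> 'a) permutes UNIV"
  shows "perm_action \<sigma> (signed_coset_sum \<rho> z d) =
    scaleF (of_int (sign \<sigma>)) (signed_coset_sum \<rho> z (\<sigma> d))"
proof (rule poly_mapping_eqI)
  fix r
  have "(\<Sum>p | p permutes UNIV \<and> p d = z. if \<rho> \<circ> p = r \<circ> \<sigma> then of_int (sign p) else 0) =
      (\<Sum>p | p permutes UNIV \<and> p (\<sigma> d) = z.
        of_int (sign \<sigma>) * (if \<rho> \<circ> p = r then of_int (sign p) else (0::complex)))"
  proof (rule sum.reindex_bij_witness[of _ "\<lambda>p. p \<circ> \<sigma>" "\<lambda>p. p \<circ> inv \<sigma>"])
    fix p assume "p \<in> {p. p permutes UNIV \<and> p d = z}"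
    then have p: "p permutes UNIV" "p d = z" by auto
    show "p \<circ> inv \<sigma> \<circ> \<sigma> = p"
      using permutes_inv_o[OF s] by (simp add: comp_assoc)
    show "p \<circ> inv \<sigma> \<in> {p. p permutes UNIV \<and> p (\<sigma> d) = z}"
      using p s by (simp add: permutes_compose permutes_inv permutes_inverses)
    have "\<rho> \<circ> (p \<circ> inv \<sigma>) = r \<longleftrightarrow> \<rho> \<circ> p = r \<circ> \<sigma>"
      using permutes_inv_o[OF s] by (metis comp_assoc comp_id)
    moreover have "sign (p \<circ> inv \<sigma>) = sign p * sign \<sigma>"
      using p s by (simp add: sign_compose_UNIV permutes_inv sign_inv_UNIV)
    ultimately show "of_int (sign \<sigma>) * (if \<rho> \<circ> (p \<circ> inv \<sigma>) = r then of_int (sign (p \<circ> inv \<sigma>)) else 0) =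
        (if \<rho> \<circ> p = r \<circ> \<sigma> then of_int (sign p) else (0::complex))"
      by (simp flip: of_int_mult)
  next
    fix p assume "p \<in> {p. p permutes UNIV \<and> p (\<sigma> d) = z}"
    then have p: "p permutes UNIV" "p (\<sigma> d) = z" by auto
    show "p \<circ> \<sigma> \<circ> inv \<sigma> = p"
      using permutes_inv_o[OF s] by (simp add: comp_assoc)
    show "p \<circ> \<sigma> \<in> {p. p permutes UNIV \<and> p d = z}"
      using p s by (simp add: permutes_compose)
  qed
  then show "Poly_Mapping.lookup (perm_action \<sigma> (signed_coset_sum \<rho> z d)) r =
      Poly_Mapping.lookup (scaleF (of_int (sign \<sigma>)) (signed_coset_sum \<rho> z (\<sigma> d))) r"
    by (simp add: lookup_perm_action[OF s] lookup_signed_coset_sum sum_distrib_left)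
qed

text \<open>
  The sum runs over all permutations, and interchanging the two entries \<open>y\<close>, \<open>z\<close> of a common row
  changes the sign of every term but not its tabloid.
\<close>
lemma sum_signed_coset_sum:
  assumes "y \<noteq> z" "\<rho> y = \<rho> z"
  shows "(\<Sum>d\<in>UNIV. signed_coset_sum \<rho> z d) = (0 :: ('a::finite \<Rightarrow> nat) \<Rightarrow>\<^sub>0 complex)"
proof (rule poly_mapping_eqI)
  fix r
  let ?t = "transpose y z"
  have \<rho>t: "\<rho> \<circ> ?t = \<rho>" using assms by (auto simp: fun_eq_iff transpose_def)
  have t: "?t permutes UNIV" by (rule permutes_swap_id) auto
  let ?g = "\<lambda>p. if \<rho> \<circ> p = r then of_int (sign p) else (0::complex)"
  have "Poly_Mapping.lookup (\<Sum>d\<in>UNIV. signed_coset_sum \<rho> z d) r =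
      (\<Sum>d\<in>UNIV. \<Sum>p | p \<in> {p. p permutes UNIV} \<and> p d = z. ?g p)"
    by (simp add: lookup_sum lookup_signed_coset_sum)
  also have "\<dots> = (\<Sum>d\<in>UNIV. \<Sum>p | p \<in> {p. p permutes UNIV} \<and> inv p z = d. ?g p)"
    by (intro sum.cong refl Collect_cong conj_cong) (auto simp: permutes_inv_eq)
  also have "\<dots> = (\<Sum>p | p permutes UNIV. ?g p)"
    by (rule sum.group) auto
  also have "\<dots> = 0"
  proof -
    have "(\<Sum>p | p permutes UNIV. ?g p) = (\<Sum>p | p permutes UNIV. ?g (?t \<circ> p))"
      by (rule setum_permutations_compose_left[OF t])
    also have "\<dots> = (\<Sum>p | p permutes UNIV. - ?g p)"
      using assms by (intro sum.cong refl)
        (auto simp: \<rho>t sign_compose_UNIV t sign_swap_id simp flip: comp_assoc)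
    also have "\<dots> = - (\<Sum>p | p permutes UNIV. ?g p)" by (rule sum_negf)
    finally show ?thesis by simp
  qed
  finally show "Poly_Mapping.lookup (\<Sum>d\<in>UNIV. signed_coset_sum \<rho> z d) r = Poly_Mapping.lookup 0 r"
    by simp
qed

text \<open>
  When \<open>y\<close> and \<open>z\<close> are the only two entries of \<open>\<rho>\<close> in a common row, precisely two permutations
  have the same tabloid as \<open>p0\<close>, namely \<open>p0\<close> and its product with the transposition of \<open>y\<close> and
  \<open>z\<close>.  They belong to the cosets of \<open>d\<close> and of \<open>c\<close>.  Hence the coefficients at such tabloids
  provide dual functionals.
\<close>
lemma lookup_signed_coset_sum_eq:
  assumes \<rho>: "\<And>u v. \<rho> u = \<rho> v \<Longrightarrow> u = v \<or> {u, v} = {y, z}" "\<rho> y = \<rho> z" and yz: "y \<noteq> z"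
    and p0: "p0 permutes UNIV" "p0 d = z" "p0 c = y"
  shows "Poly_Mapping.lookup (signed_coset_sum \<rho> z e) (\<rho> \<circ> p0) =
    of_int (sign (p0 :: 'a::finite \<Rightarrow> 'a)) * (of_bool (e = d) - of_bool (e = c))"
proof -
  let ?t = "transpose y z"
  have t: "?t permutes UNIV" by (rule permutes_swap_id) auto
  have iff: "\<rho> \<circ> p = \<rho> \<circ> p0 \<longleftrightarrow> p = p0 \<or> p = ?t \<circ> p0" if p: "p permutes UNIV" for p
  proof
    assume eq: "\<rho> \<circ> p = \<rho> \<circ> p0"
    let ?s = "p \<circ> inv p0"
    have s: "?s permutes UNIV" using p p0 by (simp add: permutes_compose permutes_inv)
    have "\<rho> (?s x) = \<rho> x" for x
      using eq permutes_inverses[OF p0(1)] by (metis comp_apply)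
    then have "?s x = x" if "x \<notin> {y, z}" for x
      using \<rho>(1)[of "?s x" x] that by auto
    then have "?s permutes {y, z}" by (intro permutes_superset[OF s]) auto
    then have "?s = id \<or> ?s = ?t" by (simp add: permutes_doubleton_iff)
    moreover have "?s \<circ> p0 = p" using permutes_inv_o[OF p0(1)] by (simp add: comp_assoc)
    ultimately show "p = p0 \<or> p = ?t \<circ> p0" by (metis id_comp)
  next
    have "\<rho> \<circ> ?t = \<rho>" using \<rho>(2) by (auto simp: fun_eq_iff transpose_def)
    then show "p = p0 \<or> p = ?t \<circ> p0 \<Longrightarrow> \<rho> \<circ> p = \<rho> \<circ> p0" by (metis comp_assoc)
  qed
  have "(?t \<circ> p0) d = y" using p0 by simp
  then have ne: "?t \<circ> p0 \<noteq> p0" using p0(2) yz by metis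
  have "p0 u = p0 v \<longleftrightarrow> u = v" for u v
    using permutes_inj[OF p0(1)] by (rule inj_eq)
  then have "p0 e = z \<longleftrightarrow> e = d" "p0 e = y \<longleftrightarrow> e = c"
    using p0 by metis+
  moreover have "?t u = z \<longleftrightarrow> u = y" for u
    using yz by (simp add: transpose_def)
  ultimately have e: "p0 e = z \<longleftrightarrow> e = d" "?t (p0 e) = z \<longleftrightarrow> e = c" by simp_all
  have "Poly_Mapping.lookup (signed_coset_sum \<rho> z e) (\<rho> \<circ> p0) =
      (\<Sum>p | p permutes UNIV. if p e = z \<and> (p = p0 \<or> p = ?t \<circ> p0) then of_int (sign p) else 0)"
    unfolding lookup_signed_coset_sum
    by (rule sum.mono_neutral_cong_left) (auto simp: iff)
  also have "\<dots> = (\<Sum>p\<in>{p0, ?t \<circ> p0}. if p e = z then of_int (sign p) else 0)"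
    by (rule sum.mono_neutral_cong_right) (auto simp: p0 t permutes_compose)
  also have "\<dots> = of_int (sign p0) * (of_bool (e = d) - of_bool (e = c))"
    using ne[symmetric] by (simp add: e sign_compose_UNIV[OF t p0(1)] sign_swap_id yz)
  finally show ?thesis .
qed

lemma polytabloid_signed_coset_sum:
  assumes p: "(p :: 'a::finite \<Rightarrow> 'a) permutes UNIV" "p d = z"
    and C: "column_stabilizer (T \<circ> p) = {q. q permutes UNIV \<and> q d = d}"
  shows "polytabloid (T \<circ> p) = scaleF (of_int (sign p)) (signed_coset_sum (fst \<circ> T) z d)"
proof (rule poly_mapping_eqI)
  fix r
  let ?g = "\<lambda>q. if fst \<circ> T \<circ> p \<circ> inv q = r then of_int (sign q) else (0::complex)"
  have "Poly_Mapping.lookup (polytabloid (T \<circ> p)) r = (\<Sum>q | q permutes UNIV \<and> q d = d. ?g q)"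
    by (simp add: polytabloid_def C lookup_sum lookup_single when_def comp_assoc)
  also have "\<dots> = (\<Sum>q | q permutes UNIV \<and> q d = z.
      of_int (sign p) * (if fst \<circ> T \<circ> q = r then of_int (sign q) else 0))"
  proof (rule sum.reindex_bij_witness[of _ "\<lambda>q. inv q \<circ> p" "\<lambda>q. p \<circ> inv q"])
    fix q assume "q \<in> {q. q permutes UNIV \<and> q d = d}"
    then have q: "q permutes UNIV" "q d = d" by auto
    have "inv (p \<circ> inv q) = q \<circ> inv p"
      using q p by (metis o_inv_distrib permutes_bij permutes_inv permutes_inv_inv)
    then show "inv (p \<circ> inv q) \<circ> p = q"
      by (simp add: comp_assoc permutes_inv_o[OF p(1)])
    have "inv q d = d" using q by (simp add: permutes_inv_eq)
    then show "p \<circ> inv q \<in> {q. q permutes UNIV \<and> q d = z}"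
      using q p by (simp add: permutes_compose permutes_inv)
    have "sign (p \<circ> inv q) = sign p * sign q"
      using p q by (simp add: sign_compose_UNIV permutes_inv sign_inv_UNIV)
    then show "of_int (sign p) * (if fst \<circ> T \<circ> (p \<circ> inv q) = r then of_int (sign (p \<circ> inv q)) else 0) = ?g q"
      by (simp add: comp_assoc flip: of_int_mult)
  next
    fix q assume "q \<in> {q. q permutes UNIV \<and> q d = z}"
    then have q: "q permutes UNIV" "q d = z" by auto
    have "inv (inv q \<circ> p) = inv p \<circ> q"
      using q p by (metis o_inv_distrib permutes_bij permutes_inv permutes_inv_inv)
    then show "p \<circ> inv (inv q \<circ> p) = q"
      by (simp add: permutes_inv_o[OF p(1)] flip: comp_assoc)
    show "inv q \<circ> p \<in> {q. q permutes UNIV \<and> q d = d}"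
      using q p by (simp add: permutes_compose permutes_inv permutes_inv_eq)
  qed
  finally show "Poly_Mapping.lookup (polytabloid (T \<circ> p)) r =
      Poly_Mapping.lookup (scaleF (of_int (sign p)) (signed_coset_sum (fst \<circ> T) z d)) r"
    by (simp add: lookup_signed_coset_sum sum_distrib_left)
qed

lemma cells_hook: "cells (Suc (Suc 0) # replicate k (Suc 0)) = insert (0, Suc 0) ({..<Suc k} \<times> {0})"
proof (intro set_eqI)
  fix c :: "nat \<times> nat"
  obtain i j where c: "c = (i, j)" by (cases c)
  show "c \<in> cells (Suc (Suc 0) # replicate k (Suc 0)) \<longleftrightarrow> c \<in> insert (0, Suc 0) ({..<Suc k} \<times> {0})"
    unfolding c by (cases i) (auto simp: cells_def)
qed

lemma column_stabilizer_hook: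
  assumes T: "(T :: 'a::finite \<Rightarrow> _) \<in> tableaux (2 # replicate k 1)" and d: "T d = (0, 1)"
  shows "column_stabilizer T = {q. q permutes UNIV \<and> q d = d}"
proof -
  have inj: "T x = T y \<longleftrightarrow> x = y" for x y
    using T by (auto simp: tableaux_def bij_betw_def inj_eq)
  have col: "snd (T x) = of_bool (x = d)" for x
  proof -
    have "T x \<in> insert (0, Suc 0) ({..<Suc k} \<times> {0})"
      using T unfolding tableaux_def bij_betw_def One_nat_def numeral_2_eq_2 cells_hook by blast
    then show ?thesis using inj[of x d] d by auto
  qed
  have "(\<forall>x. (q x = d) = (x = d)) \<longleftrightarrow> q d = d" if "q permutes UNIV" for q
    using permutes_inj[OF that] by (auto simp: inj_def)
  then show ?thesis
    by (auto simp: column_stabilizer_def fun_eq_iff col)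
qed

text \<open>
  The \<open>n\<close> signed coset sums span the Specht module.  Their only relation is that they add up to
  zero, so omitting one of them, here the one of \<open>y\<close>, leaves a basis.  A permutation \<open>\<sigma>\<close> sends
  the sum of \<open>d\<close> to \<open>sign \<sigma>\<close> times the sum of \<open>\<sigma> d\<close>, and the sum of \<open>y\<close> is minus the sum of the
  others; so the diagonal entry at \<open>d\<close> is \<open>sign \<sigma>\<close> if \<open>\<sigma>\<close> fixes \<open>d\<close>, \<open>- sign \<sigma>\<close> if \<open>\<sigma> d = y\<close>,
  and 0 otherwise.
\<close>
theorem irr_char_standard_sign:
  assumes s: "(\<sigma> :: 'a::finite \<Rightarrow> 'a) permutes UNIV" and n: "CARD('a) \<ge> 2"
  shows "irr_char (2 # replicate (CARD('a) - 2) 1) \<sigma> =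
    of_int (sign \<sigma>) * (of_nat (card {x. \<sigma> x = x}) - 1)"
proof -
  let ?\<mu> = "2 # replicate (CARD('a) - 2) 1"
  let ?L = "Poly_Mapping.lookup :: (('a \<Rightarrow> nat) \<Rightarrow>\<^sub>0 complex) \<Rightarrow> _"
  have cl: "cells ?\<mu> = insert (0, 1) ({..<CARD('a) - 1} \<times> {0})"
  proof -
    obtain m where m: "CARD('a) = Suc (Suc m)"
      using n that[of "CARD('a) - 2"] by simp
    show ?thesis using cells_hook[of m] by (simp add: m flip: numeral_2_eq_2)
  qed
  have card: "card (cells ?\<mu>) = CARD('a)" "finite (cells ?\<mu>)"
    using n by (simp_all only: cl) (auto simp: card_insert_if card_cartesian_product)
  obtain T0 :: "'a \<Rightarrow> _" where T0: "T0 \<in> tableaux ?\<mu>"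
    using tableaux_nonempty[OF card] by blast
  then have bij: "bij_betw T0 UNIV (cells ?\<mu>)" by (simp add: tableaux_def)
  have inj: "T0 u = T0 v \<longleftrightarrow> u = v" for u v
    using bij by (auto simp: bij_betw_def inj_eq)
  have "(0, 0) \<in> range T0" "(0, 1) \<in> range T0"
    using bij n unfolding bij_betw_def by (simp_all only: cl) auto
  then obtain y z where y: "T0 y = (0, 0)" and z: "T0 z = (0, 1)" by (metis rangeE)
  define \<rho> where "\<rho> = fst \<circ> T0"
  have yz: "y \<noteq> z" using y z by auto
  have \<rho>yz: "\<rho> y = \<rho> z" by (simp add: \<rho>_def y z)
  have \<rho>: "u = v \<or> {u, v} = {y, z}" if "\<rho> u = \<rho> v" for u v
  proof -
    have col: "w = z \<or> snd (T0 w) = 0" for w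
    proof -
      have "T0 w \<in> insert (0, 1) ({..<CARD('a) - 1} \<times> {0})"
        using bij unfolding cl bij_betw_def by blast
      then show ?thesis using z inj[of w z] by auto
    qed
    have "w = y" if "snd (T0 w) = 0" "fst (T0 w) = 0" for w
      using that inj[of w y] y by (simp add: prod_eq_iff)
    moreover have "fst (T0 u) = fst (T0 v)" "fst (T0 z) = 0"
      using that z by (simp_all add: \<rho>_def)
    ultimately show ?thesis
      using col[of u] col[of v] inj[of u v] by (metis insert_commute prod.collapse)
  qed
  let ?W = "signed_coset_sum \<rho> z"
  define V where "V = formal.span (?W ` (-{y}))"
  have WV: "?W d \<in> V" for d
  proof (cases "d = y")
    case True
    have "?W y + (\<Sum>d\<in>-{y}. ?W d) = (\<Sum>d\<in>UNIV. ?W d)"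
      by (subst sum.remove[of UNIV y]) (auto simp: Compl_eq_Diff_UNIV)
    then have "?W y = - (\<Sum>d\<in>-{y}. ?W d)"
      using sum_signed_coset_sum[of y z \<rho>] yz \<rho>yz by (simp add: eq_neg_iff_add_eq_0)
    also have "\<dots> \<in> V"
      unfolding V_def by (intro formal.span_neg formal.span_sum formal.span_base) auto
    finally show ?thesis using True by simp
  qed (auto simp: V_def intro!: formal.span_base)
  have pt: "polytabloid (T0 \<circ> p) = scaleF (of_int (sign p)) (?W d)"
    and tab: "T0 \<circ> p \<in> tableaux ?\<mu>" if p: "p permutes UNIV" "p d = z" for p d
  proof -
    show t: "T0 \<circ> p \<in> tableaux ?\<mu>"
      using bij permutes_bij[OF p(1)] bij_betw_trans by (auto simp: tableaux_def)
    show "polytabloid (T0 \<circ> p) = scaleF (of_int (sign p)) (?W d)"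
      unfolding \<rho>_def using p z by (intro polytabloid_signed_coset_sum column_stabilizer_hook[OF t]) auto
  qed
  have "polytabloid T \<in> V" if T: "T \<in> tableaux ?\<mu>" for T :: "'a \<Rightarrow> _"
  proof -
    define p where "p = inv_into UNIV T0 \<circ> T"
    have "bij p"
      unfolding p_def using T bij tableaux_def bij_betw_inv_into bij_betw_trans by blast
    then have p: "p permutes UNIV" by (intro bij_imp_permutes) auto
    have "T0 \<circ> p = T"
      using bij T by (auto simp: p_def fun_eq_iff bij_betw_def tableaux_def) (metis f_inv_into_f rangeI)
    then show ?thesis
      using pt[OF p, of "inv p z"] WV permutes_inverses[OF p] V_def by (auto simp: formal.span_scale)
  qed
  then have "specht ?\<mu> \<subseteq> V"
    unfolding specht_def V_def by (intro formal.span_minimal) auto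
  moreover have "?W d \<in> specht ?\<mu>" for d
  proof -
    have p: "transpose d z permutes UNIV" "transpose d z d = z" by (auto intro: permutes_swap_id)
    have "?W d = scaleF (of_int (sign (transpose d z))) (polytabloid (T0 \<circ> transpose d z))"
      by (rule poly_mapping_eqI) (simp add: pt[OF p] sign_def)
    then show ?thesis
      unfolding specht_def using tab[OF p] by (metis formal.span_scale formal.span_base imageI)
  qed
  then have "V \<subseteq> specht ?\<mu>"
    unfolding specht_def V_def by (intro formal.span_minimal) auto
  ultimately have sp: "specht ?\<mu> = formal.span (?W ` (-{y}))" by (simp add: V_def)
  \<comment> \<open>The tabloid of \<open>T0 \<circ> P d\<close> has \<open>d\<close> and \<open>y\<close> in its first row and so sees only the sums of \<open>d\<close> and \<open>y\<close>.\<close>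
  have "\<exists>p. p permutes UNIV \<and> p d = z \<and> p y = y" if "d \<noteq> y" for d
    by (rule exists_permutation_two_points[of d y z y]) (use that yz in auto)
  then obtain P where P: "P d permutes UNIV" "P d d = z" "P d y = y" if "d \<noteq> y" for d
    by metis
  let ?\<phi> = "\<lambda>d v. of_int (sign (P d)) * ?L v (\<rho> \<circ> P d)"
  have sq: "of_int (sign p) * of_int (sign p) = (1::complex)" for p :: "'a \<Rightarrow> 'a"
    by (simp flip: of_int_mult)
  have \<phi>W: "?\<phi> d (?W e) = of_bool (e = d) - of_bool (e = y)" if "d \<noteq> y" for d e
    using lookup_signed_coset_sum_eq[OF \<rho> \<rho>yz yz P[OF that], of e]
    by (simp only: mult.assoc[symmetric] sq mult_1_left)
  have "trace_on (formal.span (?W ` (-{y}))) (perm_action \<sigma>) =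
      (\<Sum>d\<in>-{y}. ?\<phi> d (perm_action \<sigma> (?W d)))"
  proof (rule trace_on_dual_family[where \<phi> = ?\<phi>])
    show "module_hom scaleF (*) (?\<phi> d)" for d by (rule module_hom_lookup)
    show "?\<phi> d (?W e) = of_bool (d = e)" if "d \<in> -{y}" "e \<in> -{y}" for d e
      using that \<phi>W[of d e] by auto
    show "perm_action \<sigma> (?W d) \<in> formal.span (?W ` (-{y}))" for d
      using WV V_def by (simp add: perm_action_signed_coset_sum[OF s] formal.span_scale)
  qed (simp_all add: module_hom_perm_action s)
  also have "\<dots> = (\<Sum>d\<in>-{y}. of_int (sign \<sigma>) * (of_bool (\<sigma> d = d) - of_bool (\<sigma> d = y)))"
  proof (intro sum.cong refl)
    fix d assume "d \<in> -{y}"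
    then show "?\<phi> d (perm_action \<sigma> (?W d)) = of_int (sign \<sigma>) * (of_bool (\<sigma> d = d) - of_bool (\<sigma> d = y))"
      using \<phi>W[of d "\<sigma> d"] by (simp add: perm_action_signed_coset_sum[OF s] mult.left_commute)
  qed
  also have "\<dots> = of_int (sign \<sigma>) * (of_nat (card {x. \<sigma> x = x}) - 1)"
    unfolding sum_distrib_left[symmetric] sum_fixed_points_minus_one[OF s] ..
  finally show ?thesis by (simp only: irr_char_def sp)
qed

section \<open>Doubling in a finite abelian group\<close>

lemma card_subgroup_dvd:
  fixes H :: "'g::{finite, ab_group_add} set"
  assumes zero: "0 \<in> H" and minus: "\<And>x y. x \<in> H \<Longrightarrow> y \<in> H \<Longrightarrow> x - y \<in> H"
  shows "card H dvd CARD('g)"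
proof -
  define C where "C = range (\<lambda>a. (+) a ` H)"
  have cls: "x \<in> (+) a ` H \<longleftrightarrow> x - a \<in> H" for x a
    by (auto simp: image_iff) (metis add.commute diff_add_cancel)
  have "card H * card C = card (\<Union>C)"
  proof (rule card_partition)
    show "card c = card H" if "c \<in> C" for c
      using that by (auto simp: C_def card_image)
    show "c \<inter> d = {}" if "c \<in> C" "d \<in> C" "c \<noteq> d" for c d
    proof (rule ccontr)
      obtain a b where ab: "c = (+) a ` H" "d = (+) b ` H" using \<open>c \<in> C\<close> \<open>d \<in> C\<close> by (auto simp: C_def)
      assume "c \<inter> d \<noteq> {}"
      then obtain x where "x \<in> (+) a ` H" "x \<in> (+) b ` H" unfolding ab by blast
      then have x: "x - a \<in> H" "x - b \<in> H" by (simp_all only: cls)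
      have "a - b \<in> H" "b - a \<in> H"
        using minus[OF x(2,1)] minus[OF x] by simp_all
      then have "y - a \<in> H \<longleftrightarrow> y - b \<in> H" for y
        using minus[of "y - a" "b - a"] minus[of "y - b" "a - b"] by auto
      then have "c = d" unfolding ab by (auto simp only: cls set_eq_iff)
      then show False using that by simp
    qed
  qed auto
  also have "\<Union>C = UNIV"
  proof -
    have "x \<in> (+) x ` H" for x using zero by (simp add: cls)
    then show ?thesis by (auto simp: C_def)
  qed
  finally show ?thesis by (metis dvd_triv_left)
qed

text \<open>
  An element \<open>t \<noteq> 0\<close> with \<open>t + t = 0\<close> would generate a subgroup of order 2, so doubling is injective.
\<close>
lemma card_halves_odd:
  fixes d :: "'g::{finite, ab_group_add}"
  assumes "odd CARD('g)"
  shows "card {c. c + c = d} = 1"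
proof -
  have tors: "t = 0" if "t + t = 0" for t :: 'g
  proof (rule ccontr)
    assume "t \<noteq> 0"
    have "- t = t" using that by (simp add: minus_unique)
    then have "card {0, t} dvd CARD('g)"
      using that by (intro card_subgroup_dvd) auto
    moreover have "card {0, t} = 2" using \<open>t \<noteq> 0\<close> by simp
    ultimately show False using assms by simp
  qed
  have "inj (\<lambda>c :: 'g. c + c)"
  proof (rule injI)
    fix a b :: 'g assume "a + a = b + b"
    then have "(a - b) + (a - b) = 0" by (simp add: algebra_simps)
    then show "a = b" using tors[of "a - b"] by simp
  qed
  moreover from this have "surj (\<lambda>c :: 'g. c + c)" by (simp add: finite_UNIV_inj_surj)
  then obtain e where e: "d = e + e" by (metis surjD)
  ultimately have "c + c = d \<longleftrightarrow> c = e" for c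
    using inj_eq[of "\<lambda>c :: 'g. c + c" c e] by simp
  then have "{c. c + c = d} = {e}" by simp
  then show ?thesis by simp
qed

text \<open>
  Existence: otherwise \<open>x\<close> and \<open>- x\<close> differ for all \<open>x \<noteq> 0\<close>, and pairing them makes the group order
  odd.  Uniqueness: two different involutions generate a subgroup of order 4.
\<close>
lemma exists_unique_involution:
  assumes "CARD('g::{finite, ab_group_add}) mod 4 = 2"
  obtains t :: "'g::{finite, ab_group_add}" where "\<And>c. c + c = 0 \<longleftrightarrow> c = 0 \<or> c = t" "t \<noteq> 0"
proof -
  have "\<exists>t :: 'g. t \<noteq> 0 \<and> t + t = 0"
  proof (rule ccontr)
    assume "\<not> ?thesis"
    then have ne: "- x \<noteq> x" if "x \<noteq> 0" for x :: 'g
      using that by (metis add.right_inverse)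
    \<comment> \<open>The pairs of opposite elements partition the nonzero elements.\<close>
    define C where "C = (\<lambda>x :: 'g. {x, - x}) ` (UNIV - {0})"
    have "2 * card C = card (\<Union>C)"
    proof (rule card_partition)
      show "card c = 2" if "c \<in> C" for c
        using that ne by (auto simp: C_def) (metis card_2_iff)
      show "c \<inter> d = {}" if "c \<in> C" "d \<in> C" "c \<noteq> d" for c d
        using that by (auto simp: C_def)
    qed auto
    also have "\<Union>C = UNIV - {0}" by (auto simp: C_def)
    finally have "2 * card C = CARD('g) - 1" by (simp add: card_Diff_singleton)
    then show False using assms by presburger
  qed
  then obtain t :: 'g where t: "t \<noteq> 0" "t + t = 0" by blast
  moreover have "c = 0 \<or> c = t" if c: "c + c = 0" for c
  proof (rule ccontr)
    assume ne: "\<not> ?thesis"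
    have neg: "- t = t" "- c = c" using t c by (simp_all add: minus_unique)
    have red: "t + (t + x) = x" "c + (c + x) = x" for x
      using t c by (simp_all flip: add.assoc)
    have sub: "x - t = x + t" "x - c = x + c" "x - (t + c) = x + (t + c)" for x
      using neg by (metis diff_conv_add_uminus minus_add_distrib add.commute)+
    have "card {0, t, c, t + c} dvd CARD('g)"
      by (rule card_subgroup_dvd) (auto simp: sub neg t c red add_ac simp del: add_uminus_conv_diff)
    moreover have "t + c \<noteq> 0" using ne neg by (metis minus_unique)
    then have "card {0, t, c, t + c} = 4" using ne t(1) by (auto simp: card_insert_if)
    ultimately have "4 dvd CARD('g)" by simp
    then show False using assms by presburger
  qed
  ultimately have "c + c = 0 \<longleftrightarrow> c = 0 \<or> c = t" for c by auto
  then show thesis using that[of t] t(1) by blast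
qed

lemma card_halves_singly_even:
  fixes d :: "'g::{finite, ab_group_add}"
  assumes "CARD('g) mod 4 = 2"
  shows "card {c. c + c = d} = 2 * of_bool (d \<in> range (\<lambda>c. c + c))"
proof (cases "d \<in> range (\<lambda>c. c + c)")
  case True
  then obtain e where e: "d = e + e" by auto
  obtain t :: 'g where t: "\<And>c. c + c = 0 \<longleftrightarrow> c = 0 \<or> c = t" "t \<noteq> 0"
    using exists_unique_involution assms by blast
  have "c + c = d \<longleftrightarrow> c = e \<or> c = e + t" for c
  proof -
    have "c + c = d \<longleftrightarrow> (c - e) + (c - e) = 0" by (auto simp: e algebra_simps)
    also have "\<dots> \<longleftrightarrow> c = e \<or> c = e + t" unfolding t by (simp add: diff_eq_eq add.commute)
    finally show ?thesis .
  qed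
  then have "{c. c + c = d} = {e, e + t}" by auto
  then show ?thesis using True t by simp
qed auto

text \<open>
  The fibres of doubling over its image have two elements, so the image is a subgroup of index 2.
\<close>
lemma doubles_index_two:
  fixes a b :: "'g::{finite, ab_group_add}"
  assumes n: "CARD('g) mod 4 = 2"
    and a: "a \<notin> range (\<lambda>c. c + c)" and b: "b \<notin> range (\<lambda>c. c + c)"
  shows "a + b \<in> range (\<lambda>c. c + c)"
proof -
  let ?H = "range (\<lambda>c :: 'g. c + c)"
  have "CARD('g) = (\<Sum>d\<in>?H. card {c. c \<in> UNIV \<and> c + c = d})"
    using sum.group[of UNIV ?H "\<lambda>c. c + c" "\<lambda>_. 1 :: nat"] by simp
  also have "\<dots> = 2 * card ?H" by (simp add: card_halves_singly_even[OF n])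
  finally have card: "CARD('g) = 2 * card ?H" .
  have "(+) a ` ?H \<inter> ?H = {}"
  proof (rule ccontr)
    assume "\<not> ?thesis"
    then obtain x y where "a + (x + x) = y + y" by auto
    then have "a = (y - x) + (y - x)" by (simp add: algebra_simps)
    then show False using a by blast
  qed
  then have "card ((+) a ` ?H \<union> ?H) = CARD('g)"
    by (simp add: card_Un_disjoint card_image card)
  then have "(+) a ` ?H \<union> ?H = UNIV" by (intro card_subset_eq) auto
  moreover have "- b \<notin> ?H"
  proof
    assume "- b \<in> ?H"
    then obtain x where "- b = x + x" by auto
    then have "b = (- x) + (- x)" by (metis minus_add_distrib minus_minus)
    then show False using b by blast
  qed
  ultimately have "- b \<in> (+) a ` ?H" by blast
  then obtain x where "- b = a + (x + x)" by auto
  have "a + b = a - (- b)" by simp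
  also have "\<dots> = (- x) + (- x)" unfolding \<open>- b = a + (x + x)\<close> by simp
  finally have "a + b = (- x) + (- x)" .
  then show ?thesis by blast
qed

lemma add_mem_doubles_iff_diff:
  "(a :: 'g::ab_group_add) + b \<in> range (\<lambda>c. c + c) \<longleftrightarrow> a - b \<in> range (\<lambda>c. c + c)"
proof
  assume "a + b \<in> range (\<lambda>c. c + c)"
  then obtain c where "a + b = c + c" by auto
  then have "a - b = (c - b) + (c - b)" by (simp add: algebra_simps)
  then show "a - b \<in> range (\<lambda>c. c + c)" by blast
next
  assume "a - b \<in> range (\<lambda>c. c + c)"
  then obtain c where "a - b = c + c" by auto
  then have "a + b = (c + b) + (c + b)" by (simp add: algebra_simps)
  then show "a + b \<in> range (\<lambda>c. c + c)" by blast
qed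

text \<open>
  The doubles form a subgroup of index 2, so the indicator function of the elements outside it
  is a homomorphism to the integers modulo 2.  Summing its values at \<open>b + \<sigma> b\<close> over all
  \<open>b\<close> counts every element twice, so an even number of the \<open>b + \<sigma> b\<close> lie outside the subgroup; the group order is even as well.
\<close>
lemma even_card_doubles:
  fixes \<sigma> :: "'g::{finite, ab_group_add} \<Rightarrow> 'g"
  assumes n: "CARD('g) mod 4 = 2" and s: "\<sigma> permutes UNIV"
  shows "even (card {b. b + \<sigma> b \<in> range (\<lambda>c. c + c)})"
proof -
  let ?H = "range (\<lambda>c :: 'g. c + c)"
  define \<psi> :: "'g \<Rightarrow> nat" where "\<psi> x = of_bool (x \<notin> ?H)" for x
  have closed: "x \<in> ?H \<Longrightarrow> x + y \<in> ?H \<longleftrightarrow> y \<in> ?H" for x y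
  proof -
    assume "x \<in> ?H"
    then obtain e where e: "x = e + e" by auto
    have "x + y \<in> ?H" if "y = c + c" for c
    proof -
      have "x + y = (c + e) + (c + e)" by (simp add: e that algebra_simps)
      then show ?thesis by blast
    qed
    moreover have "y \<in> ?H" if "x + y = c + c" for c
    proof -
      have "y = (x + y) - x" by simp
      also have "\<dots> = (c - e) + (c - e)" unfolding that by (simp add: e algebra_simps)
      finally show ?thesis by blast
    qed
    ultimately show ?thesis by blast
  qed
  \<comment> \<open>The product corrects for the two nonzero values adding up to 2 instead of 0.\<close>
  have \<psi>: "\<psi> (x + y) + 2 * (\<psi> x * \<psi> y) = \<psi> x + \<psi> y" for x y
  proof (cases "x \<in> ?H")
    case True
    then show ?thesis using closed[of x y] by (simp add: \<psi>_def)
  next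
    case False
    then show ?thesis
      using closed[of y x] doubles_index_two[OF n, of x y] by (cases "y \<in> ?H") (simp_all add: \<psi>_def add.commute)
  qed
  have "(\<Sum>b\<in>UNIV. \<psi> (b + \<sigma> b)) + 2 * (\<Sum>b\<in>UNIV. \<psi> b * \<psi> (\<sigma> b)) =
      (\<Sum>b\<in>UNIV. \<psi> b) + (\<Sum>b\<in>UNIV. \<psi> (\<sigma> b))"
    by (simp only: sum_distrib_left sum.distrib[symmetric] \<psi>)
  also have "(\<Sum>b\<in>UNIV. \<psi> (\<sigma> b)) = (\<Sum>b\<in>UNIV. \<psi> b)"
    using sum.permute[OF s, of \<psi>] by (simp add: comp_def)
  finally have "even (\<Sum>b\<in>UNIV. \<psi> (b + \<sigma> b))" by presburger
  moreover have "(\<Sum>b\<in>UNIV. \<psi> (b + \<sigma> b)) = card (- {b. b + \<sigma> b \<in> ?H})"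
    by (simp add: \<psi>_def sum_of_bool_eq Collect_neg_eq)
  moreover have "card (- {b. b + \<sigma> b \<in> ?H}) + card {b. b + \<sigma> b \<in> ?H} = CARD('g)"
    by (subst card_Un_disjoint[symmetric]) auto
  ultimately show ?thesis using n by presburger
qed

section \<open>Coefficients of immanants of Cayley tables\<close>

definition cayley_monomial :: "('g::{finite, ab_group_add} \<Rightarrow> 'g) \<Rightarrow> 'g \<Rightarrow>\<^sub>0 nat"
  where "cayley_monomial \<sigma> = (\<Sum>a\<in>UNIV. Poly_Mapping.single (a + \<sigma> a) 1)"

lemma prod_cayley_table:
  "(\<Prod>a\<in>UNIV. cayley_table a (\<sigma> a)) = Poly_Mapping.single (cayley_monomial \<sigma>) 1"
proof -
  have "(\<Prod>a\<in>A. cayley_table a (\<sigma> a)) = Poly_Mapping.single (\<Sum>a\<in>A. Poly_Mapping.single (a + \<sigma> a) 1) 1"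
    if "finite A" for A
    using that by induction (simp_all add: cayley_table_def indet_def mult_single)
  then show ?thesis by (simp add: cayley_monomial_def)
qed

lemma lookup_immanant_cayley_table:
  "Poly_Mapping.lookup (immanant \<mu> cayley_table) m =
    (\<Sum>\<sigma> | \<sigma> permutes UNIV \<and> cayley_monomial \<sigma> = m. irr_char \<mu> \<sigma>)"
proof -
  have "Poly_Mapping.lookup (immanant \<mu> cayley_table) m =
    (\<Sum>\<sigma> | \<sigma> permutes UNIV. if cayley_monomial \<sigma> = m then irr_char \<mu> \<sigma> else 0)"
    by (simp add: immanant_def prod_cayley_table const_poly_def mult_single lookup_sum lookup_single when_def)
  also have "\<dots> = (\<Sum>\<sigma> | \<sigma> permutes UNIV \<and> cayley_monomial \<sigma> = m. irr_char \<mu> \<sigma>)"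
    by (rule sum.mono_neutral_cong_right) auto
  finally show ?thesis .
qed

lemma sum_lookup_cayley_monomial:
  "(\<Sum>h\<in>H. Poly_Mapping.lookup (cayley_monomial \<sigma>) h) = card {b. b + \<sigma> b \<in> H}"
proof -
  have "(\<Sum>h\<in>H. Poly_Mapping.lookup (cayley_monomial \<sigma>) h) =
      (\<Sum>b\<in>UNIV. \<Sum>h\<in>H. if b + \<sigma> b = h then 1 else 0)"
    by (subst sum.swap) (simp add: cayley_monomial_def lookup_sum lookup_single when_def del: One_nat_def)
  also have "\<dots> = (\<Sum>b\<in>UNIV. of_bool (b + \<sigma> b \<in> H))"
    by (intro sum.cong refl) (simp add: of_bool_def)
  finally show ?thesis by (simp add: sum_of_bool_eq)
qed

section \<open>Translating permutations\<close>

text \<open>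
  The group acts on its own permutations by \<open>\<sigma> \<mapsto> (\<lambda>a. \<sigma> (a + c) + c)\<close>.  This is not conjugation:
  translating the same way on both sides preserves the multiset of the sums \<open>a + \<sigma> a\<close> and
  the sign, but in general changes the number of fixed points.
\<close>
definition translate :: "'g::ab_group_add \<Rightarrow> ('g \<Rightarrow> 'g) \<Rightarrow> 'g \<Rightarrow> 'g"
  where "translate c \<sigma> = (+) c \<circ> \<sigma> \<circ> (+) c"

lemma add_permutes: "(+) (c :: 'g::ab_group_add) permutes UNIV"
  by (intro bij_imp_permutes) (auto intro: bij_betw_byWitness[where f' = "\<lambda>x. x - c"])

lemma translate_permutes: "\<sigma> permutes UNIV \<Longrightarrow> translate c \<sigma> permutes UNIV"
  unfolding translate_def by (intro permutes_compose add_permutes)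

lemma translate_translate: "translate (- c) (translate c \<sigma>) = \<sigma>"
  by (simp add: translate_def fun_eq_iff)

lemma sign_translate:
  assumes "(\<sigma> :: 'g::{finite, ab_group_add} \<Rightarrow> 'g) permutes UNIV"
  shows "sign (translate c \<sigma>) = sign \<sigma>"
  using assms by (simp add: translate_def sign_compose_UNIV permutes_compose add_permutes)

lemma sum_UNIV_translate: "(\<Sum>a\<in>UNIV. f (c + a)) = (\<Sum>a\<in>UNIV. f (a :: 'g::{finite, ab_group_add}))"
  using sum.permute[OF add_permutes, of f c] by (simp add: comp_def)

lemma cayley_monomial_translate: "cayley_monomial (translate c \<sigma>) = cayley_monomial \<sigma>"
proof -
  have "cayley_monomial (translate c \<sigma>) = (\<Sum>a\<in>UNIV. Poly_Mapping.single ((c + a) + \<sigma> (c + a)) 1)"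
    by (simp add: cayley_monomial_def translate_def add_ac)
  also have "\<dots> = cayley_monomial \<sigma>"
    unfolding cayley_monomial_def by (rule sum_UNIV_translate)
  finally show ?thesis .
qed

text \<open>
  With \<open>b = c + a\<close>, the translate fixes \<open>a\<close> if and only if \<open>c + c = b - \<sigma> b\<close>.
\<close>
lemma sum_fixed_points_translate:
  fixes \<sigma> :: "'g::{finite, ab_group_add} \<Rightarrow> 'g"
  shows "(\<Sum>c\<in>UNIV. card {a. translate c \<sigma> a = a}) = (\<Sum>b\<in>UNIV. card {c. c + c = b - \<sigma> b})"
proof -
  have "card {a. translate c \<sigma> a = a} = (\<Sum>b\<in>UNIV. of_bool (c + c = b - \<sigma> b))" for c
  proof -
    have "card {a. translate c \<sigma> a = a} = (\<Sum>a\<in>UNIV. of_bool (c + c = (c + a) - \<sigma> (c + a)))"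
      by (auto simp: translate_def sum_of_bool_eq algebra_simps intro!: arg_cong[where f = card])
    also have "\<dots> = (\<Sum>b\<in>UNIV. of_bool (c + c = b - \<sigma> b))"
      by (rule sum_UNIV_translate)
    finally show ?thesis .
  qed
  then have "(\<Sum>c\<in>UNIV. card {a. translate c \<sigma> a = a}) = (\<Sum>b\<in>UNIV. \<Sum>c\<in>UNIV. of_bool (c + c = b - \<sigma> b))"
    by (simp only:) (rule sum.swap)
  then show ?thesis by (simp add: sum_of_bool_eq)
qed

text \<open>
  Translating by \<open>c\<close> is a bijection of the set \<open>S\<close> of permutations with the monomial \<open>m\<close>, and it
  leaves \<open>\<epsilon>\<close> unchanged.  So in the sum over \<open>S\<close> the number of fixed points of \<open>\<sigma>\<close> may be
  replaced by its average over all translates of \<open>\<sigma>\<close>.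
\<close>
lemma average_over_translates:
  fixes \<epsilon> :: "('g::{finite, ab_group_add} \<Rightarrow> 'g) \<Rightarrow> complex" and m :: "'g \<Rightarrow>\<^sub>0 nat" and N :: nat
  assumes inv: "\<And>c \<sigma>. \<sigma> permutes UNIV \<Longrightarrow> \<epsilon> (translate c \<sigma>) = \<epsilon> \<sigma>"
    and N: "\<And>\<sigma>. \<sigma> permutes UNIV \<Longrightarrow> cayley_monomial \<sigma> = m \<Longrightarrow> (\<Sum>b\<in>UNIV. card {c. c + c = b - \<sigma> b}) = N"
  defines "S \<equiv> {\<sigma>. \<sigma> permutes UNIV \<and> cayley_monomial \<sigma> = m}"
  shows "of_nat CARD('g) * (\<Sum>\<sigma>\<in>S. \<epsilon> \<sigma> * (of_nat (card {x. \<sigma> x = x}) - 1)) =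
    (of_nat N - of_nat CARD('g)) * (\<Sum>\<sigma>\<in>S. \<epsilon> \<sigma>)"
proof -
  let ?f = "\<lambda>\<sigma> :: 'g \<Rightarrow> 'g. of_nat (card {x. \<sigma> x = x}) :: complex"
  have shift: "(\<Sum>\<sigma>\<in>S. \<epsilon> \<sigma> * ?f (translate c \<sigma>)) = (\<Sum>\<sigma>\<in>S. \<epsilon> \<sigma> * ?f \<sigma>)" for c
    by (rule sum.reindex_bij_witness[of _ "translate (- c)" "translate c"])
      (use translate_translate[of "- c"] in \<open>auto simp: S_def translate_translate translate_permutes
        cayley_monomial_translate inv\<close>)
  have "of_nat CARD('g) * (\<Sum>\<sigma>\<in>S. \<epsilon> \<sigma> * ?f \<sigma>) = (\<Sum>c\<in>(UNIV::'g set). \<Sum>\<sigma>\<in>S. \<epsilon> \<sigma> * ?f (translate c \<sigma>))"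
    by (simp add: shift)
  also have "\<dots> = (\<Sum>\<sigma>\<in>S. \<epsilon> \<sigma> * of_nat (\<Sum>c\<in>UNIV. card {a. translate c \<sigma> a = a}))"
    by (subst sum.swap) (simp add: sum_distrib_left)
  also have "\<dots> = (\<Sum>\<sigma>\<in>S. \<epsilon> \<sigma> * of_nat N)"
    using N unfolding sum_fixed_points_translate by (intro sum.cong refl) (auto simp: S_def)
  also have "\<dots> = of_nat N * (\<Sum>\<sigma>\<in>S. \<epsilon> \<sigma>)"
    by (simp add: sum_distrib_left mult.commute)
  finally show ?thesis
    by (simp add: right_diff_distrib left_diff_distrib sum_subtractf)
qed

section \<open>Immanants for groups of odd and of singly even order\<close>

lemma immanant_vanishes_odd:
  assumes odd: "odd CARD('g::{finite, ab_group_add})"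
    and \<mu>: "\<And>\<sigma> :: 'g \<Rightarrow> 'g. \<sigma> permutes UNIV \<Longrightarrow> irr_char \<mu> \<sigma> = \<epsilon> \<sigma> * (of_nat (card {x. \<sigma> x = x}) - 1)"
    and inv: "\<And>c \<sigma>. \<sigma> permutes UNIV \<Longrightarrow> \<epsilon> (translate c \<sigma>) = \<epsilon> \<sigma>"
  shows "imm_monomials TYPE('g) \<mu> = 0"
proof -
  have "immanant \<mu> (cayley_table :: 'g \<Rightarrow> 'g \<Rightarrow> 'g mpoly) = 0"
  proof (rule poly_mapping_eqI)
    fix m :: "'g \<Rightarrow>\<^sub>0 nat"
    have "of_nat CARD('g) * Poly_Mapping.lookup (immanant \<mu> cayley_table) m =
        (of_nat CARD('g) - of_nat CARD('g)) *
        (\<Sum>\<sigma> | \<sigma> permutes UNIV \<and> cayley_monomial \<sigma> = m. \<epsilon> \<sigma>)"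
      unfolding lookup_immanant_cayley_table
      by (subst average_over_translates[symmetric]) (auto simp: inv \<mu> card_halves_odd[OF odd])
    then show "Poly_Mapping.lookup (immanant \<mu> cayley_table) m = Poly_Mapping.lookup 0 m" by simp
  qed
  then show ?thesis by (simp add: imm_monomials_def)
qed

text \<open>
  Write \<open>k\<close> for the degree of the monomial \<open>m\<close> in the indeterminates indexed by doubles.  Since
  \<open>b - \<sigma> b\<close> is a double if and only if \<open>b + \<sigma> b\<close> is, the number \<open>N\<close> of \<open>average_over_translates\<close> depends
  only on \<open>m\<close> (it is \<open>2k\<close>), and the two coefficients of \<open>m\<close> differ by the factor \<open>(2k - n) / n\<close>.  If \<open>m\<close>
  comes from a permutation then \<open>k\<close> is even while \<open>n / 2\<close> is odd, so the factor is not zero.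
\<close>
lemma imm_monomials_eq_singly_even:
  assumes n: "CARD('g::{finite, ab_group_add}) mod 4 = 2"
    and \<mu>: "\<And>\<sigma> :: 'g \<Rightarrow> 'g. \<sigma> permutes UNIV \<Longrightarrow> irr_char \<mu> \<sigma> = \<epsilon> \<sigma> * (of_nat (card {x. \<sigma> x = x}) - 1)"
    and \<nu>: "\<And>\<sigma> :: 'g \<Rightarrow> 'g. \<sigma> permutes UNIV \<Longrightarrow> irr_char \<nu> \<sigma> = \<epsilon> \<sigma>"
    and inv: "\<And>c \<sigma>. \<sigma> permutes UNIV \<Longrightarrow> \<epsilon> (translate c \<sigma>) = \<epsilon> \<sigma>"
  shows "imm_monomials TYPE('g) \<mu> = imm_monomials TYPE('g) \<nu>"
proof -
  let ?I = "\<lambda>\<mu>. immanant \<mu> (cayley_table :: 'g \<Rightarrow> 'g \<Rightarrow> 'g mpoly)"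
  let ?H = "range (\<lambda>c :: 'g. c + c)"
  have "Poly_Mapping.lookup (?I \<mu>) m = 0 \<longleftrightarrow> Poly_Mapping.lookup (?I \<nu>) m = 0" for m
  proof -
    define k where "k = (\<Sum>h\<in>?H. Poly_Mapping.lookup m h)"
    let ?S = "{\<sigma>. \<sigma> permutes UNIV \<and> cayley_monomial \<sigma> = m}"
    have count: "(\<Sum>b\<in>UNIV. card {c. c + c = b - \<sigma> b}) = 2 * k" if "cayley_monomial \<sigma> = m" for \<sigma>
    proof -
      have "(\<Sum>b\<in>UNIV. card {c. c + c = b - \<sigma> b}) = 2 * (\<Sum>b\<in>UNIV. of_bool (b + \<sigma> b \<in> ?H))"
        unfolding card_halves_singly_even[OF n] add_mem_doubles_iff_diff sum_distrib_left ..
      also have "(\<Sum>b\<in>UNIV. of_bool (b + \<sigma> b \<in> ?H)) = card {b. b + \<sigma> b \<in> ?H}"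
        by (subst sum_of_bool_eq) simp_all
      finally have "(\<Sum>b\<in>UNIV. card {c. c + c = b - \<sigma> b}) = 2 * card {b. b + \<sigma> b \<in> ?H}" .
      then show ?thesis using sum_lookup_cayley_monomial[of \<sigma> ?H] that by (simp add: k_def)
    qed
    have eq: "of_nat CARD('g) * Poly_Mapping.lookup (?I \<mu>) m =
        (of_nat (2 * k) - of_nat CARD('g)) * Poly_Mapping.lookup (?I \<nu>) m"
      using average_over_translates[of \<epsilon> m "2 * k", OF inv count]
      by (simp add: lookup_immanant_cayley_table \<mu> \<nu>)
    show ?thesis
    proof (cases "?S = {}")
      case True
      then show ?thesis by (simp add: lookup_immanant_cayley_table del: Collect_empty_eq)
    next
      case False
      then obtain \<sigma> where s: "\<sigma> permutes UNIV" "cayley_monomial \<sigma> = m" by auto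
      have "even k"
        using even_card_doubles[OF n s(1)] sum_lookup_cayley_monomial[of \<sigma> ?H] by (simp add: k_def s)
      then have "2 * k \<noteq> CARD('g)" using n by presburger
      then have ne: "of_nat (2 * k) - of_nat CARD('g) \<noteq> (0 :: complex)"
        unfolding right_minus_eq of_nat_eq_iff .
      have "Poly_Mapping.lookup (?I \<mu>) m = 0 \<longleftrightarrow> of_nat CARD('g) * Poly_Mapping.lookup (?I \<mu>) m = 0"
        by simp
      also have "\<dots> \<longleftrightarrow> Poly_Mapping.lookup (?I \<nu>) m = 0"
        unfolding eq mult_eq_0_iff using ne by blast
      finally show ?thesis .
    qed
  qed
  then have "Poly_Mapping.keys (?I \<mu>) = Poly_Mapping.keys (?I \<nu>)"
    unfolding set_eq_iff in_keys_iff by blast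
  then show ?thesis by (simp add: imm_monomials_def)
qed

theorem theorem1p5:
  fixes n :: nat
  assumes "n = CARD('g::{finite, ab_group_add})" and "n \<ge> 2"
  shows "(odd n \<longrightarrow>
           imm_monomials TYPE('g) [n - 1, 1] = 0 \<and>
           imm_monomials TYPE('g) (2 # replicate (n - 2) 1) = 0) \<and>
         (n mod 4 = 2 \<longrightarrow>
           imm_monomials TYPE('g) [n - 1, 1] = per_monomials TYPE('g) \<and>
           imm_monomials TYPE('g) (2 # replicate (n - 2) 1) = det_monomials TYPE('g))"
proof -
  have card: "CARD('g) \<ge> 2" using assms by simp
  let ?sgn = "\<lambda>\<sigma> :: 'g \<Rightarrow> 'g. of_int (sign \<sigma>) :: complex"
  have std: "irr_char [n - 1, 1] \<sigma> = 1 * (of_nat (card {x. \<sigma> x = x}) - 1)"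
    if "\<sigma> permutes UNIV" for \<sigma> :: "'g \<Rightarrow> 'g"
    using irr_char_standard[OF that card] by (simp only: assms mult_1_left)
  have std_sgn: "irr_char (2 # replicate (n - 2) 1) \<sigma> = ?sgn \<sigma> * (of_nat (card {x. \<sigma> x = x}) - 1)"
    if "\<sigma> permutes UNIV" for \<sigma> :: "'g \<Rightarrow> 'g"
    using irr_char_standard_sign[OF that card] by (simp only: assms)
  have sgn_inv: "?sgn (translate c \<sigma>) = ?sgn \<sigma>" if "\<sigma> permutes UNIV" for c \<sigma>
    using that by (simp add: sign_translate)
  show ?thesis
    unfolding per_monomials_def det_monomials_def
    using immanant_vanishes_odd[where 'g = 'g and \<mu> = "[n - 1, 1]" and \<epsilon> = "\<lambda>_. 1", OF _ std refl]
      immanant_vanishes_odd[where 'g = 'g and \<mu> = "2 # replicate (n - 2) 1" and \<epsilon> = ?sgn, OF _ std_sgn sgn_inv]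
      imm_monomials_eq_singly_even[where 'g = 'g and \<mu> = "[n - 1, 1]" and \<epsilon> = "\<lambda>_. 1", OF _ std irr_char_one_row refl]
      imm_monomials_eq_singly_even[where 'g = 'g and \<mu> = "2 # replicate (n - 2) 1" and \<epsilon> = ?sgn,
        OF _ std_sgn irr_char_one_column sgn_inv]
    by (simp only: assms(1)) blast
qed

end
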